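(* Let $\chi$ be any non-principal Dirichlet character to the prime modulus $p$, and let $N$ and $H$ be integers with $H\ge 1$ such that $\chi$ is constant on $(N,N+H]$. Then $$H<\begin{cases}7.06\,p^{1/4}\log p, & \text{for } p\geq 5\cdot 10^{18},\\ 7\,p^{1/4}\log p, & \text{for } p\geq 5\cdot 10^{55}.\end{cases}$$ (That is, the first bound holds whenever $p\ge 5\cdot10^{18}$, and the second bound holds whenever $p\ge 5\cdot 10^{55}$.)
   Context: "$\chi$ is constant on $(N,N+H]$" means that $\chi$ takes the same value at all the integers $N+1,\dots,N+H$. Here $\log$ is the natural logarithm. *)

theory Defs
  imports Complex_Main "HOL-Number_Theory.Number_Theory"
begin

(* Characters are taken as functions on all integers (extended by zero to arguments that are
   not coprime to the modulus), so that intervals may extend to negative integers. The value at 1 is forced to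
   be 1 by multiplicativity and chi 1 \<noteq> 0. *)
definition dirichlet_character :: "nat \<Rightarrow> (int \<Rightarrow> complex) \<Rightarrow> bool" where
  "dirichlet_character q chi \<longleftrightarrow>
     (\<forall>n. chi (n + int q) = chi n) \<and>
     (\<forall>m n. chi (m * n) = chi m * chi n) \<and>
     (\<forall>n. chi n \<noteq> 0 \<longleftrightarrow> coprime n (int q))"

definition principal_character :: "nat \<Rightarrow> int \<Rightarrow> complex" where
  "principal_character q = (\<lambda>n. if coprime n (int q) then 1 else 0)"

end

(* Suppose chi is constant on (N, N+H]. Dividing the integers of the run by all q <= Q produces
   a large set of residues x mod p such that chi takes the same value at x, x+1, ..., x+W; Dirichlet
   approximation of N/p shows that these quotients are essentially distinct, so there are about
   H^2/W of them. If k > 1 is the order of chi and g = (p-1)/k, then v = -1/x satisfies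
   (1 - j v)^g = 1 for all 1 <= j <= W. Stepanov's auxiliary polynomial method bounds the number of
   such v by O(W sqrt p): one constructs a nonzero combination of the functions
   v^a v^(p i) prod_j (1 - j v)^(g e_j) vanishing to high order at each of them. With W about
   log p / log 4 both estimates contradict each other once H exceeds 7 p^(1/4) log p. Treating all
   linear factors 1 - j v at once replaces Weil's bound for complete character sums; the price is
   the linear independence of the functions above, which follows from a Wronskian argument. *)

theory Submission
  imports
    Defs
    "HOL-Analysis.Harmonic_Numbers"
    "HOL-Analysis.Kronecker_Approximation_Theorem"
    "Berlekamp_Zassenhaus.Finite_Field"
    "Jordan_Normal_Form.Determinant"
begin

section \<open>Wronskians in positive characteristic\<close>

text \<open>In characteristic p the polynomials with derivative zero are those in x^p. A Wronskian
  therefore certifies independence over this ring and not just over scalars, which is what the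
  factors v^(p i) call for. Independence is proved one linear factor t at a time: modulo t^p the
  coefficients of a relation become scalars, and t^g would then have to divide a nontrivial
  combination, with coefficients of degree below A, of products of the earlier factors. A
  determinant excludes this, because products of powers have logarithmic derivatives of bounded
  height: the huge exponents g e_j do not enter its degree. For the constants, let 2 Z be about
  p^(1/4). A run of length 16 W Z = 2 Z * 8 W yields at least 16 (W - 2) Z^2 residues, while the
  auxiliary polynomial allows about 12 W Z^2 of them. Since 8 W <= 8 log p / log 4 < 6 log p, the
  constant 7 is within reach.\<close>

lemma higher_pderiv_const_mult:
  assumes "pderiv C = 0"
  shows "(pderiv ^^ l) (C * q) = C * (pderiv ^^ l) q"
  using assms by (induction l) (simp_all add: pderiv_mult)

lemma pderiv_power_char:
  fixes q :: "'a::{comm_semiring_1, semiring_no_zero_divisors} poly"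
  shows "pderiv (q ^ CHAR('a)) = 0"
  by (simp add: pderiv_power)

lemma mult_pderiv_power:
  fixes q :: "'a::idom poly"
  shows "q * pderiv (q ^ n) = of_nat n * q ^ n * pderiv q"
proof (cases n)
  case (Suc k)
  have "pderiv (q ^ Suc k) = of_nat (Suc k) * q ^ k * pderiv q"
    by (simp only: pderiv_power_Suc of_nat_poly) simp
  thus ?thesis unfolding Suc by (simp only: power_Suc mult_ac)
qed simp

text \<open>The hypothesis is the quotient rule for \<open>c / d\<close> having derivative zero.
  Multiplying this quotient by \<open>d ^ CHAR('a)\<close>, itself a constant of the derivation,
  clears the denominator.\<close>

lemma pderiv_mult_power_char_eq_0:
  fixes c d :: "'a::idom poly"
  assumes "CHAR('a) > 1" "d * pderiv c = pderiv d * c"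
  shows "pderiv (c * d ^ (CHAR('a) - 1)) = 0"
proof -
  obtain m where m: "CHAR('a) = Suc (Suc m)"
    using assms(1) by (auto simp: less_iff_Suc_add)
  have "of_nat (Suc m) = (-1 :: 'a)"
    using of_nat_CHAR[where 'a = 'a] unfolding m
    by (metis add_eq_0_iff of_nat_Suc)
  hence "pderiv (d ^ Suc m) = - (d ^ m * pderiv d)"
    by (simp only: pderiv_power_Suc) simp
  hence "pderiv (c * d ^ Suc m) = d ^ m * (d * pderiv c - pderiv d * c)"
    by (simp only: pderiv_mult) (simp add: algebra_simps)
  thus ?thesis using assms(2) by (simp add: m)
qed

text \<open>Differentiating the relation of order \<open>l\<close> and subtracting that of order
  \<open>l + 1\<close> shows that the derivatives of the coefficients satisfy the relation of order
  \<open>l\<close> as well. A combination of both relations cancels one function and loses one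
  order, so the induction is on the number of functions. The hypothesis is a linear dependence, with
  coefficients \<open>c\<close>, between the columns of the Wronskian matrix.\<close>

lemma wronskian_dependent:
  fixes w :: "'i \<Rightarrow> 'a::idom poly"
  assumes "CHAR('a) > 1" "finite S" "\<exists>s\<in>S. c s \<noteq> 0"
    and "\<And>l. l < card S \<Longrightarrow> (\<Sum>s\<in>S. c s * (pderiv ^^ l) (w s)) = 0"
  shows "\<exists>C. (\<forall>s\<in>S. pderiv (C s) = 0) \<and> (\<exists>s\<in>S. C s \<noteq> 0) \<and> (\<Sum>s\<in>S. C s * w s) = 0"
  using assms(2-)
proof (induction "card S" arbitrary: S c)
  case 0
  thus ?case by auto
next
  case (Suc n)
  obtain r where r: "r \<in> S" "c r \<noteq> 0" using Suc.prems by blast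
  define T where "T = S - {r}"
  have T: "finite T" "card T = n" "S = insert r T" "r \<notin> T"
    using Suc r by (auto simp: T_def)
  \<comment> \<open>Up to the factor \<open>c r ^ 2\<close> this is the derivative of
    \<open>c s / c r\<close>. It vanishes for \<open>s = r\<close>, so the new relation lives on
    \<open>T\<close>.\<close>
  define d where "d s = c r * pderiv (c s) - pderiv (c r) * c s" for s
  have rel: "(\<Sum>s\<in>T. d s * (pderiv ^^ l) (w s)) = 0" if l: "l < n" for l
  proof -
    have S0: "(\<Sum>s\<in>S. c s * (pderiv ^^ l) (w s)) = 0"
      and S1: "(\<Sum>s\<in>S. c s * (pderiv ^^ Suc l) (w s)) = 0"
      using Suc.prems(3)[of l] Suc.prems(3)[of "Suc l"] Suc.hyps(2) l by auto
    have "0 = pderiv (\<Sum>s\<in>S. c s * (pderiv ^^ l) (w s))" by (simp add: S0)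
    also have "\<dots> = (\<Sum>s\<in>S. pderiv (c s) * (pderiv ^^ l) (w s))
                  + (\<Sum>s\<in>S. c s * (pderiv ^^ Suc l) (w s))"
      by (simp add: pderiv_sum pderiv_mult sum.distrib algebra_simps)
    finally have S2: "(\<Sum>s\<in>S. pderiv (c s) * (pderiv ^^ l) (w s)) = 0" by (simp only: S1 add_0_right)
    have "(\<Sum>s\<in>S. d s * (pderiv ^^ l) (w s)) =
        c r * (\<Sum>s\<in>S. pderiv (c s) * (pderiv ^^ l) (w s))
        - pderiv (c r) * (\<Sum>s\<in>S. c s * (pderiv ^^ l) (w s))"
      by (simp add: d_def sum_distrib_left algebra_simps flip: sum_subtractf)
    also have "\<dots> = 0" by (simp only: S0 S2 mult_zero_right diff_self)
    finally show ?thesis using T by (simp add: d_def)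
  qed
  show ?case
  proof (cases "\<exists>s\<in>T. d s \<noteq> 0")
    case True
    obtain C where C: "\<forall>s\<in>T. pderiv (C s) = 0" "\<exists>s\<in>T. C s \<noteq> 0" "(\<Sum>s\<in>T. C s * w s) = 0"
      using Suc.hyps(1)[OF T(2)[symmetric] T(1) True] rel T(2) by auto
    have "(\<Sum>s\<in>T. (C(r := 0)) s * w s) = (\<Sum>s\<in>T. C s * w s)"
      using T by (intro sum.cong) auto
    thus ?thesis using C T by (intro exI[of _ "C(r := 0)"]) auto
  next
    case False
    \<comment> \<open>The ratios \<open>c s / c r\<close> have derivative \<open>0\<close>; multiplying by a \<open>p\<close>-th power clears denominators.\<close>
    define C where "C s = c s * c r ^ (CHAR('a) - 1)" for s
    have "c r * pderiv (c s) = pderiv (c r) * c s" if "s \<in> S" for s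
      using False that T by (cases "s = r") (auto simp: d_def mult.commute)
    hence "\<forall>s\<in>S. pderiv (C s) = 0"
      unfolding C_def using pderiv_mult_power_char_eq_0[OF assms(1)] by blast
    moreover have "C r \<noteq> 0" using r by (simp add: C_def)
    moreover have "(\<Sum>s\<in>S. C s * w s) = c r ^ (CHAR('a) - 1) * (\<Sum>s\<in>S. c s * (pderiv ^^ 0) (w s))"
      unfolding C_def sum_distrib_left by (intro sum.cong refl) (simp add: mult_ac)
    hence "(\<Sum>s\<in>S. C s * w s) = 0"
      using Suc.prems(3)[of 0] Suc.hyps(2) by simp
    ultimately show ?thesis using r by blast
  qed
qed

section \<open>Derivatives of functions with a given logarithmic derivative\<close>

text \<open>If \<open>u\<close> has logarithmic derivative \<open>\<eta> / \<Phi>\<close>, then the \<open>l\<close>-th derivative of \<open>b * u\<close> is this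
  polynomial times \<open>u / \<Phi> ^ l\<close>. Its degree does not involve the degree of \<open>u\<close>.\<close>

primrec twisted_deriv :: "'a::idom poly \<Rightarrow> 'a poly \<Rightarrow> nat \<Rightarrow> 'a poly \<Rightarrow> 'a poly" where
  "twisted_deriv \<Phi> \<eta> 0 b = b"
| "twisted_deriv \<Phi> \<eta> (Suc l) b = \<Phi> * pderiv (twisted_deriv \<Phi> \<eta> l b) + (\<eta> - of_nat l * pderiv \<Phi>) * twisted_deriv \<Phi> \<eta> l b"

lemma higher_pderiv_twisted_deriv:
  assumes "\<Phi> * pderiv u = \<eta> * u"
  shows "\<Phi> ^ l * (pderiv ^^ l) (b * u) = twisted_deriv \<Phi> \<eta> l b * u"
proof (induction l)
  case 0
  thus ?case by simp
next
  case (Suc l)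
  define X where "X = (pderiv ^^ l) (b * u)"
  define B where "B = twisted_deriv \<Phi> \<eta> l b"
  have IH: "\<Phi> ^ l * X = B * u" using Suc by (simp add: X_def B_def)
  have "\<Phi> * pderiv (\<Phi> ^ l * X) = of_nat l * pderiv \<Phi> * (\<Phi> ^ l * X) + \<Phi> ^ Suc l * pderiv X"
    using mult_pderiv_power[of \<Phi> l] by (simp add: pderiv_mult algebra_simps)
  hence "\<Phi> ^ Suc l * pderiv X = \<Phi> * pderiv (B * u) - of_nat l * pderiv \<Phi> * (B * u)"
    by (simp add: IH)
  also have "\<dots> = (\<Phi> * pderiv B + (\<eta> - of_nat l * pderiv \<Phi>) * B) * u"
    using assms by (simp add: pderiv_mult algebra_simps)
  finally show ?case by (simp add: X_def B_def)
qed

lemma degree_pderiv_bound: "degree (pderiv q) \<le> degree q - 1"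
  by (rule degree_le) (auto simp: coeff_pderiv coeff_eq_0)

lemma degree_twisted_deriv:
  assumes "degree \<Phi> \<le> d" "degree \<eta> \<le> d - 1" "degree b \<le> m"
  shows "degree (twisted_deriv \<Phi> \<eta> l b) \<le> m + l * (d - 1)"
proof (induction l)
  case 0
  thus ?case using assms by simp
next
  case (Suc l)
  define B where "B = twisted_deriv \<Phi> \<eta> l b"
  have B: "degree B \<le> m + l * (d - 1)" using Suc by (simp add: B_def)
  have 1: "degree (\<Phi> * pderiv B) \<le> degree B + (d - 1)"
  \<comment> \<open>For constant \<open>B\<close> the truncated \<open>degree B - 1\<close> does not
    provide the saving of one; there the derivative itself vanishes.\<close>
  proof (cases "degree B = 0")
    case True
    hence "pderiv B = 0" by (elim degree_eq_zeroE) (simp add: pderiv_pCons)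
    thus ?thesis by simp
  next
    case False
    thus ?thesis using degree_mult_le[of \<Phi> "pderiv B"] degree_pderiv_bound[of B] assms by linarith
  qed
  have "degree (of_nat l * pderiv \<Phi>) \<le> d - 1"
    using degree_mult_le[of "of_nat l" "pderiv \<Phi>"] degree_pderiv_bound[of \<Phi>] assms by simp
  hence "degree (\<eta> - of_nat l * pderiv \<Phi>) \<le> d - 1"
    using assms by (intro degree_diff_le)
  hence 2: "degree ((\<eta> - of_nat l * pderiv \<Phi>) * B) \<le> degree B + (d - 1)"
    using degree_mult_le[of "\<eta> - of_nat l * pderiv \<Phi>" B] by linarith
  show ?case using degree_add_le[OF 1 2] B by (simp add: B_def)
qed

text \<open>Linear independence of the polynomials \<open>x\<^sup>a u\<^sub>e\<close> with \<open>a < A\<close> over the ring of polynomials with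
  derivative zero, that is, over the polynomials in \<open>x\<^sup>p\<close>.\<close>

definition const_indep :: "nat \<Rightarrow> 'e set \<Rightarrow> ('e \<Rightarrow> 'a::idom poly) \<Rightarrow> bool" where
  "const_indep A E u \<longleftrightarrow>
     (\<forall>C. (\<forall>e\<in>E. \<forall>a<A. pderiv (C e a) = 0) \<longrightarrow>
          (\<Sum>e\<in>E. (\<Sum>a<A. C e a * monom 1 a) * u e) = 0 \<longrightarrow>
          (\<forall>e\<in>E. \<forall>a<A. C e a = 0))"

lemma const_indepD:
  assumes "const_indep A E u" "\<And>e a. e \<in> E \<Longrightarrow> a < A \<Longrightarrow> pderiv (C e a) = 0"
    "(\<Sum>e\<in>E. (\<Sum>a<A. C e a * monom 1 a) * u e) = 0" "e \<in> E" "a < A"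
  shows "C e a = 0"
  using assms unfolding const_indep_def by blast

lemma sum_coeff_monom:
  fixes b :: "'a::comm_semiring_1 poly"
  assumes "degree b < A"
  shows "(\<Sum>a<A. [:coeff b a:] * monom 1 a) = b"
proof -
  obtain m where m: "A = Suc m" using assms by (cases A) auto
  have "(\<Sum>a<A. [:coeff b a:] * monom 1 a) = (\<Sum>a\<le>m. monom (coeff b a) a)"
    unfolding m lessThan_Suc_atMost by (intro sum.cong refl) (simp add: smult_monom)
  also have "\<dots> = b"
    using assms m by (intro poly_as_sum_of_monoms') auto
  finally show ?thesis .
qed

lemma power_dvd_higher_pderiv:
  fixes t :: "'a::idom poly"
  assumes "t ^ m dvd q"
  shows "t ^ (m - l) dvd (pderiv ^^ l) q"
proof (induction l)
  case 0
  thus ?case using assms by simp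
next
  case (Suc l)
  show ?case
  proof (cases "m - l")
    case 0
    thus ?thesis by simp
  next
    case (Suc r)
    then obtain k where k: "(pderiv ^^ l) q = t ^ Suc r * k"
      using Suc.IH by (metis dvdE)
    have "pderiv (t ^ Suc r * k) = t ^ r * (t * pderiv k + of_nat (Suc r) * pderiv t * k)"
      unfolding pderiv_mult pderiv_power_Suc by (simp add: algebra_simps of_nat_poly)
    moreover have "m - Suc l = r" using Suc by simp
    ultimately show ?thesis by (simp add: k)
  qed
qed

text \<open>The twisted derivatives of the \<open>b e\<close> form a square matrix whose determinant
  is nonzero by independence and has a degree not involving the degrees of the \<open>u e\<close>.
  Its rows, weighted by the \<open>u e\<close>, give \<open>\<Phi> ^ l\<close> times the
  \<open>l\<close>-th derivative of the sum, hence multiples of \<open>t ^ (g - l)\<close>. By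
  Cramer's rule a high power of \<open>t\<close> divides the determinant, and comparing degrees
  bounds \<open>g\<close>.\<close>

lemma power_dvd_exponent_bound:
  fixes u \<eta> b :: "'e \<Rightarrow> 'a::field poly"
  assumes "CHAR('a) > 1" "finite E" "const_indep A E u"
    and u: "\<And>e. e \<in> E \<Longrightarrow> \<Phi> * pderiv (u e) = \<eta> e * u e"
    and deg: "\<And>e. e \<in> E \<Longrightarrow> degree (\<eta> e) \<le> d - 1" "degree \<Phi> \<le> d" "\<Phi> \<noteq> 0"
    and t: "prime_elem t" "degree t = 1" "\<And>e. e \<in> E \<Longrightarrow> \<not> t dvd u e"
    and b: "\<And>e. e \<in> E \<Longrightarrow> degree (b e) < A" "e0 \<in> E" "b e0 \<noteq> 0"
    and dvd: "t ^ g dvd (\<Sum>e\<in>E. b e * u e)"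
  shows "g \<le> card E * (A - 1 + (card E - 1) * (d - 1)) + (card E - 1)"
proof -
  \<comment> \<open>An index with \<open>b e = 0\<close> would produce a zero column and make the
    determinant vanish.\<close>
  define E' where "E' = {e\<in>E. b e \<noteq> 0}"
  define n where "n = card E'"
  have E': "finite E'" "E' \<subseteq> E" "e0 \<in> E'" using assms by (auto simp: E'_def)
  have n: "n \<le> card E" "n > 0"
    using E' assms(2) by (auto simp: n_def card_mono card_gt_0_iff)
  obtain h where h: "bij_betw h {..<n} E'"
    using E' by (metis n_def bij_betw_from_nat_into_finite)
  have hE: "h j \<in> E" "b (h j) \<noteq> 0" if "j < n" for j
    using h that by (auto simp: bij_betw_def E'_def)
  define M where "M = Matrix.mat n n (\<lambda>(l, j). twisted_deriv \<Phi> (\<eta> (h j)) l (b (h j)))"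
  have M: "M \<in> carrier_mat n n" by (simp add: M_def)
  have u0: "u (h j) \<noteq> 0" if "j < n" for j
    using t(3)[OF hE(1)[OF that]] by auto
  have "det M \<noteq> 0"
  proof
    assume "det M = 0"
    then obtain v where v: "v \<in> carrier_vec n" "v \<noteq> 0\<^sub>v n" "M *\<^sub>v v = 0\<^sub>v n"
      using det_0_iff_vec_prod_zero[OF M] by blast
    then obtain j0 where j0: "j0 < n" "v $ j0 \<noteq> 0"
      by (metis carrier_vecD eq_vecI index_zero_vec)
    have Mv: "(\<Sum>j<n. twisted_deriv \<Phi> (\<eta> (h j)) l (b (h j)) * v $ j) = 0" if "l < n" for l
    proof -
      have "(M *\<^sub>v v) $ l = (\<Sum>j<n. twisted_deriv \<Phi> (\<eta> (h j)) l (b (h j)) * v $ j)"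
        using v(1) that by (simp add: M_def scalar_prod_def atLeast0LessThan)
      thus ?thesis using that by (simp add: v(3))
    qed
    \<comment> \<open>A kernel vector \<open>v\<close> of the twisted derivatives corresponds to the
      coefficients \<open>v $ j / u (h j)\<close> for the true derivatives; the product of all
      \<open>u (h i)\<close> clears these denominators.\<close>
    define c where "c j = v $ j * (\<Prod>i\<in>{..<n} - {j}. u (h i))" for j
    have c0: "\<exists>j\<in>{..<n}. c j \<noteq> 0"
      using j0 u0 by (intro bexI[of _ j0]) (auto simp: c_def)
    have "(\<Sum>j<n. c j * (pderiv ^^ l) (b (h j) * u (h j))) = 0" if l: "l < n" for l
    proof -
      have "\<Phi> ^ l * (\<Sum>j<n. c j * (pderiv ^^ l) (b (h j) * u (h j)))
          = (\<Sum>j<n. c j * (\<Phi> ^ l * (pderiv ^^ l) (b (h j) * u (h j))))"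
        by (simp add: sum_distrib_left mult_ac)
      also have "\<dots> = (\<Sum>j<n. c j * (twisted_deriv \<Phi> (\<eta> (h j)) l (b (h j)) * u (h j)))"
        using hE u by (intro sum.cong refl) (simp add: higher_pderiv_twisted_deriv)
      also have "\<dots> = (\<Sum>j<n. (\<Prod>i<n. u (h i)) * (twisted_deriv \<Phi> (\<eta> (h j)) l (b (h j)) * v $ j))"
        by (intro sum.cong refl) (simp add: c_def prod.remove mult_ac)
      also have "\<dots> = 0" by (simp add: Mv l flip: sum_distrib_left)
      finally show ?thesis using deg by simp
    qed
    with wronskian_dependent[of "{..<n}" c "\<lambda>j. b (h j) * u (h j)", OF assms(1) _ c0]
    obtain C where C: "\<forall>j<n. pderiv (C j) = 0" "\<exists>j<n. C j \<noteq> 0"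
        "(\<Sum>j<n. C j * (b (h j) * u (h j))) = 0" by (auto simp: Ball_def Bex_def)
    \<comment> \<open>Expanding \<open>C j * b (h j)\<close> in powers of x brings the relation into
      the form required by \<open>const_indep\<close>; indices outside \<open>E'\<close> get the
      coefficient zero.\<close>
    define K where "K e a = (if b e = 0 then 0 else C (the_inv_into {..<n} h e) * [:coeff (b e) a:])" for e a
    have inv: "the_inv_into {..<n} h (h j) = j" if "j < n" for j
      using h that by (intro the_inv_into_f_f) (auto simp: bij_betw_def)
    have invE: "the_inv_into {..<n} h e < n" if "e \<in> E'" for e
      using h that the_inv_into_into[of h "{..<n}" e "{..<n}"] by (auto simp: bij_betw_def)
    have K: "(\<Sum>a<A. K e a * monom 1 a) = C (the_inv_into {..<n} h e) * b e" if "e \<in> E" for e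
    proof (cases "b e = 0")
      case False
      hence "(\<Sum>a<A. K e a * monom 1 a) = C (the_inv_into {..<n} h e) * (\<Sum>a<A. [:coeff (b e) a:] * monom 1 a)"
        by (simp add: K_def sum_distrib_left mult_ac)
      thus ?thesis by (simp only: sum_coeff_monom[OF b(1)[OF that]])
    qed (simp add: K_def)
    have "(\<Sum>e\<in>E. (\<Sum>a<A. K e a * monom 1 a) * u e) =
        (\<Sum>e\<in>E. C (the_inv_into {..<n} h e) * b e * u e)"
      using K by (intro sum.cong) auto
    also have "\<dots> = (\<Sum>e\<in>E'. C (the_inv_into {..<n} h e) * b e * u e)"
      using assms(2) by (intro sum.mono_neutral_right) (auto simp: E'_def)
    also have "\<dots> = (\<Sum>j<n. C j * (b (h j) * u (h j)))"
      using inv by (subst sum.reindex_bij_betw[OF h, symmetric]) (auto intro!: sum.cong)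
    finally have K0: "(\<Sum>e\<in>E. (\<Sum>a<A. K e a * monom 1 a) * u e) = 0" using C by simp
    have "pderiv (K e a) = 0" if "e \<in> E" for e a
      using C(1) invE that by (auto simp: K_def E'_def pderiv_smult)
    from const_indepD[OF assms(3) this K0]
    have K00: "K e a = 0" if "e \<in> E" "a < A" for e a using that by blast
    obtain j where j: "j < n" "C j \<noteq> 0" using C by blast
    show False
      using K00[OF hE(1) b(1)[OF hE(1)], of j j] j hE[of j] inv[of j] by (auto simp: K_def)
  qed
  moreover have "t ^ (g - (n - 1)) dvd det M"
  proof (cases "g - (n - 1)")
    case (Suc r)
    \<comment> \<open>Cramer's rule, read off from the first row of
      \<open>adj_mat M * M\<close>.\<close>
    have eq: "det M * u (h 0) = (\<Sum>l<n. adj_mat M $$ (0, l) * (\<Sum>j<n. M $$ (l, j) * u (h j)))"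
    proof -
      have adj: "(\<Sum>l<n. adj_mat M $$ (0, l) * M $$ (l, j)) = (if j = 0 then det M else 0)" if "j < n" for j
      proof -
        have "(\<Sum>l<n. adj_mat M $$ (0, l) * M $$ (l, j)) = (adj_mat M * M) $$ (0, j)"
          using that n M adj_mat(1)[OF M] by (simp add: scalar_prod_def atLeast0LessThan)
        thus ?thesis using that n by (simp add: adj_mat(3)[OF M])
      qed
      have "(\<Sum>l<n. adj_mat M $$ (0, l) * (\<Sum>j<n. M $$ (l, j) * u (h j)))
          = (\<Sum>j<n. (\<Sum>l<n. adj_mat M $$ (0, l) * M $$ (l, j)) * u (h j))"
        unfolding sum_distrib_left sum_distrib_right
        by (subst sum.swap) (simp add: mult_ac)
      also have "\<dots> = (\<Sum>j<n. if j = 0 then det M * u (h 0) else 0)"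
        by (intro sum.cong refl) (simp add: adj)
      finally show ?thesis using n by simp
    qed
    have dv: "t ^ (g - (n - 1)) dvd (\<Sum>j<n. M $$ (l, j) * u (h j))" if l: "l < n" for l
    proof -
      have "(\<Sum>j<n. M $$ (l, j) * u (h j)) = (\<Sum>j<n. \<Phi> ^ l * (pderiv ^^ l) (b (h j) * u (h j)))"
        using l by (intro sum.cong refl) (simp add: M_def higher_pderiv_twisted_deriv[OF u[OF hE(1)]])
      also have "\<dots> = \<Phi> ^ l * (pderiv ^^ l) (\<Sum>j<n. b (h j) * u (h j))"
        by (simp add: higher_pderiv_sum sum_distrib_left)
      also have "(\<Sum>j<n. b (h j) * u (h j)) = (\<Sum>e\<in>E'. b e * u e)"
        by (rule sum.reindex_bij_betw[OF h])
      also have "\<dots> = (\<Sum>e\<in>E. b e * u e)"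
        using assms(2) by (intro sum.mono_neutral_left) (auto simp: E'_def)
      finally show ?thesis
        using power_dvd_higher_pderiv[OF dvd, of l] l
        by (auto intro!: dvd_mult power_le_dvd[of t "g - l"])
    qed
    have "t ^ (g - (n - 1)) dvd det M * u (h 0)"
      unfolding eq by (intro dvd_sum dvd_mult[OF dv]) simp
    hence dv': "t ^ (g - (n - 1)) dvd u (h 0) * det M" by (simp only: mult.commute)
    have "\<not> t dvd u (h 0)" using t(3) hE(1)[of 0] n by blast
    thus ?thesis using prime_power_dvd_multD[OF t(1) dv'] Suc by simp
  qed auto
  ultimately have "degree (t ^ (g - (n - 1))) \<le> degree (det M)"
    by (intro dvd_imp_degree_le)
  moreover have "degree (t ^ (g - (n - 1))) = g - (n - 1)"
    using t(1,2) by (subst degree_power_eq) auto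
  moreover have "degree (det M) \<le> (A - 1 + (n - 1) * (d - 1)) * n"
  proof (rule degree_det_le[OF _ M])
    fix l j assume lj: "l < n" "j < n"
    have "degree (M $$ (l, j)) \<le> (A - 1) + l * (d - 1)"
    proof -
      have "M $$ (l, j) = twisted_deriv \<Phi> (\<eta> (h j)) l (b (h j))" using lj by (simp add: M_def)
      thus ?thesis
        using lj(2) b(1)[OF hE(1)[of j]] deg(1)[OF hE(1)[of j]] deg(2)
        by (simp only:) (rule degree_twisted_deriv, auto)
    qed
    also have "\<dots> \<le> A - 1 + (n - 1) * (d - 1)"
      using lj by (intro add_left_mono mult_right_mono) auto
    finally show "degree (M $$ (l, j)) \<le> A - 1 + (n - 1) * (d - 1)" .
  qed
  ultimately have "g \<le> (A - 1 + (n - 1) * (d - 1)) * n + (n - 1)" by linarith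
  also have "\<dots> \<le> (A - 1 + (card E - 1) * (d - 1)) * card E + (card E - 1)"
    using n by (intro add_mono mult_mono order_refl diff_le_mono) auto
  finally show ?thesis by (simp add: mult.commute)
qed

section \<open>Independence of products of powers of linear polynomials\<close>

lemma degree_linear_power:
  fixes t :: "'a::idom poly"
  assumes "degree t = 1"
  shows "degree (t ^ m) = m"
  using assms by (subst degree_power_eq) auto

section \<open>Descent modulo the p-th power of a linear polynomial\<close>

lemma pderiv_eq_0_imp_degree_eq_0:
  fixes r :: "'a::idom poly"
  assumes "pderiv r = 0" "degree r < CHAR('a)"
  shows "degree r = 0"
proof (rule ccontr)
  assume "degree r \<noteq> 0"
  then obtain m where m: "degree r = Suc m" by (cases "degree r") auto
  have "of_nat (Suc m) * coeff r (Suc m) = 0"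
    using arg_cong[OF assms(1), of "\<lambda>q. coeff q m"] by (simp add: coeff_pderiv)
  moreover have "coeff r (Suc m) \<noteq> 0" using m by (metis leading_coeff_0_iff degree_0 nat.distinct(1))
  ultimately have "CHAR('a) dvd Suc m" by (simp only: mult_eq_0_iff of_nat_eq_0_iff_char_dvd) simp
  thus False using assms(2) m by (auto dest: dvd_imp_le)
qed

text \<open>Differentiating \<open>C = T * q + r\<close> with \<open>T = t ^ CHAR('a)\<close> gives
  \<open>T * pderiv q = - pderiv r\<close>, which the degrees permit only if both sides vanish. This
  is what turns coefficients with derivative zero into scalars modulo \<open>T\<close>.\<close>

lemma const_div_mod_power_char:
  fixes t C :: "'a::field poly"
  assumes "CHAR('a) > 0" "degree t = 1" "pderiv C = 0"
  shows "pderiv (C div t ^ CHAR('a)) = 0" "degree (C mod t ^ CHAR('a)) = 0"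
proof -
  define T where "T = t ^ CHAR('a)"
  define q r where "q = C div T" and "r = C mod T"
  have dT: "degree T = CHAR('a)" unfolding T_def by (rule degree_linear_power) fact
  have dr: "degree r < CHAR('a)"
    using degree_mod_less'[of T C] dT assms(1) unfolding r_def
    by (metis degree_0 degree_mod_less less_numeral_extra(3))
  have "pderiv (T * q + r) = 0" using assms(3) by (simp add: q_def r_def)
  hence *: "T * pderiv q = - pderiv r"
    by (simp add: T_def pderiv_add pderiv_mult pderiv_power_char add_eq_0_iff)
  have "pderiv q = 0"
  proof (rule ccontr)
    assume "pderiv q \<noteq> 0"
    hence "degree (T * pderiv q) \<ge> CHAR('a)"
      using dT assms(1) by (subst degree_mult_eq) auto
    thus False using * dr degree_pderiv_bound[of r] by simp
  qed
  thus "pderiv (C div t ^ CHAR('a)) = 0" by (simp add: q_def T_def)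
  hence "pderiv r = 0" using * by (simp add: q_def T_def)
  from pderiv_eq_0_imp_degree_eq_0[OF this dr]
  show "degree (C mod t ^ CHAR('a)) = 0" by (simp add: r_def T_def)
qed

text \<open>Infinite descent: dividing a relation by \<open>t ^ CHAR('a)\<close> gives another
  relation whose coefficients have derivative zero, so every coefficient is divisible by arbitrarily
  high powers of \<open>t\<close>.\<close>

lemma const_indep_descent:
  fixes t :: "'a::field poly" and u :: "'e \<Rightarrow> 'a poly"
  assumes "CHAR('a) > 0" "degree t = 1"
    and step: "\<And>C e a. \<lbrakk>\<And>e a. e \<in> E \<Longrightarrow> a < A \<Longrightarrow> pderiv (C e a) = 0;
       (\<Sum>e\<in>E. (\<Sum>a<A. C e a * monom 1 a) * u e) = 0; e \<in> E; a < A\<rbrakk> \<Longrightarrow> t ^ CHAR('a) dvd C e a"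
  shows "const_indep A E u"
proof -
  define T where "T = t ^ CHAR('a)"
  have T0: "T \<noteq> 0" using assms(2) by (auto simp: T_def)
  have dvd: "T ^ m dvd C e a"
    if "\<And>e a. e \<in> E \<Longrightarrow> a < A \<Longrightarrow> pderiv (C e a) = 0"
       "(\<Sum>e\<in>E. (\<Sum>a<A. C e a * monom 1 a) * u e) = 0" "e \<in> E" "a < A" for m C e a
    using that
  proof (induction m arbitrary: C e a)
    case (Suc m)
    define C' where "C' e a = C e a div T" for e a
    have C': "C e a = T * C' e a" if "e \<in> E" "a < A" for e a
      using step[OF Suc.prems(1,2) that] by (simp add: C'_def T_def)
    have 1: "pderiv (C' e a) = 0" if "e \<in> E" "a < A" for e a
      unfolding C'_def T_def using Suc.prems(1)[OF that] by (intro const_div_mod_power_char assms)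
    have "T * (\<Sum>e\<in>E. (\<Sum>a<A. C' e a * monom 1 a) * u e) = (\<Sum>e\<in>E. (\<Sum>a<A. C e a * monom 1 a) * u e)"
      unfolding sum_distrib_left sum_distrib_right
      by (intro sum.cong refl) (simp add: C' mult_ac)
    hence 2: "(\<Sum>e\<in>E. (\<Sum>a<A. C' e a * monom 1 a) * u e) = 0" using Suc.prems(2) T0 by simp
    from Suc.IH[of C', OF 1 2 Suc.prems(3,4)] C'[OF Suc.prems(3,4)] show ?case by simp
  qed simp
  show ?thesis unfolding const_indep_def
  proof safe
    fix C e a
    assume C: "\<forall>e\<in>E. \<forall>a<A. pderiv (C e a) = 0" "(\<Sum>e\<in>E. (\<Sum>a<A. C e a * monom 1 a) * u e) = 0"
       "e \<in> E" "a < A"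
    define m where "m = Suc (degree (C e a))"
    have "t ^ (CHAR('a) * m) dvd C e a"
      using dvd[of C e a m] C by (simp add: T_def power_mult)
    moreover have "degree (C e a) < CHAR('a) * m"
    proof -
      have "1 * m \<le> CHAR('a) * m" using assms(1) by (intro mult_right_mono) auto
      thus ?thesis by (simp add: m_def)
    qed
    hence "degree (C e a) < degree (t ^ (CHAR('a) * m))"
      by (simp only: degree_linear_power[OF assms(2)])
    ultimately show "C e a = 0" by (metis dvd_imp_degree_le not_less)
  qed
qed

text \<open>The start of the induction, with no linear factor present. Modulo x^p a relation has
  scalar coefficients, hence is a polynomial of degree below \<open>A \<le> CHAR('a)\<close> that is
  divisible by x^p.\<close>

lemma const_indep_singleton:
  fixes e0 :: 'e
  fixes u :: "'e \<Rightarrow> 'a::field poly"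
  assumes "A \<le> CHAR('a)" "CHAR('a) > 0" "u e0 = 1"
  shows "const_indep A {e0} u"
proof (rule const_indep_descent[where t = "[:0, 1:]"])
  fix C :: "'e \<Rightarrow> nat \<Rightarrow> 'a poly" and e a
  assume C: "\<And>e a. e \<in> {e0} \<Longrightarrow> a < A \<Longrightarrow> pderiv (C e a) = 0"
    "(\<Sum>e\<in>{e0}. (\<Sum>a<A. C e a * monom 1 a) * u e) = 0" "e \<in> {e0}" "a < A"
  define T where "T = [:0, 1 :: 'a:] ^ CHAR('a)"
  define \<rho> where "\<rho> a = C e0 a mod T" for a
  have dT: "degree T = CHAR('a)" unfolding T_def by (rule degree_linear_power) simp
  have r0: "degree (\<rho> a) = 0" if "a < A" for a
    unfolding \<rho>_def T_def using C(1) that assms by (intro const_div_mod_power_char) auto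
  define R where "R = (\<Sum>a<A. monom (coeff (\<rho> a) 0) a)"
  have R: "R = (\<Sum>a<A. \<rho> a * monom 1 a)" unfolding R_def
  proof (intro sum.cong refl)
    fix a assume "a \<in> {..<A}"
    then obtain c where "\<rho> a = [:c:]" using r0 by (meson degree_eq_zeroE lessThan_iff)
    thus "monom (coeff (\<rho> a) 0) a = \<rho> a * monom 1 a" by (simp add: smult_monom)
  qed
  have "R mod T = (\<Sum>a<A. C e0 a * monom 1 a) mod T"
    unfolding R \<rho>_def by (subst (1 2) mod_sum_eq[symmetric]) (simp add: mod_simps)
  also have "\<dots> = 0" using C(2) assms(3) by simp
  finally have "T dvd R" by (simp add: dvd_eq_mod_eq_0)
  moreover have "degree R < degree T"
    unfolding dT R_def using assms C(4)
    by (intro degree_sum_less) (auto intro: le_less_trans[OF degree_monom_le])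
  ultimately have "R = 0" by (metis dvd_imp_degree_le not_less)
  have "coeff R a = coeff (\<rho> a) 0"
    using C(4) by (simp add: R_def coeff_sum)
  hence "\<rho> a = 0" using r0[OF C(4)] \<open>R = 0\<close> by (metis coeff_0 degree_0_id pCons_0_0)
  thus "[:0, 1:] ^ CHAR('a) dvd C e a"
    using C(3) by (simp add: \<rho>_def T_def dvd_eq_mod_eq_0)
qed (use assms in auto)

text \<open>Let \<open>j0\<close> be the least exponent with a coefficient not divisible by
  \<open>t ^ CHAR('a)\<close>. All other terms of the relation are divisible by
  \<open>t ^ (g * j0 + g)\<close>: the later ones by their power of \<open>t\<close>, the earlier
  ones because \<open>s * g \<le> CHAR('a)\<close>. So \<open>t ^ g\<close> divides the part
  belonging to \<open>j0\<close>, and \<open>g\<close> is too large for that.\<close>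

lemma const_indep_extend:
  fixes u \<eta> :: "nat list \<Rightarrow> 'a::field poly"
  assumes "CHAR('a) > 1" "finite E" "const_indep A E u"
    and u: "\<And>e. e \<in> E \<Longrightarrow> \<Phi> * pderiv (u e) = \<eta> e * u e"
    and deg: "\<And>e. e \<in> E \<Longrightarrow> degree (\<eta> e) \<le> d - 1" "degree \<Phi> \<le> d" "\<Phi> \<noteq> 0"
    and t: "prime_elem t" "degree t = 1" "\<And>e. e \<in> E \<Longrightarrow> \<not> t dvd u e"
    and u_Cons: "\<And>j e. e \<in> E \<Longrightarrow> u (j # e) = t ^ (g * j) * u e"
    and g: "card E * (A - 1 + (card E - 1) * (d - 1)) + (card E - 1) < g"
    and s: "s * g \<le> CHAR('a)"
  shows "const_indep A ((\<lambda>(j, e). j # e) ` ({..<s} \<times> E)) u"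
proof (rule const_indep_descent[where t = t])
  define T where "T = t ^ CHAR('a)"
  fix C e1 a1
  let ?E = "(\<lambda>(j, e). j # e) ` ({..<s} \<times> E)"
  assume C: "\<And>e a. e \<in> ?E \<Longrightarrow> a < A \<Longrightarrow> pderiv (C e a) = 0"
    "(\<Sum>e\<in>?E. (\<Sum>a<A. C e a * monom 1 a) * u e) = 0" "e1 \<in> ?E" "a1 < A"
  define P where "P j = (\<Sum>e\<in>E. (\<Sum>a<A. C (j # e) a * monom 1 a) * u e)" for j
  have "(\<Sum>e\<in>?E. (\<Sum>a<A. C e a * monom 1 a) * u e) =
      (\<Sum>(j, e)\<in>{..<s} \<times> E. (\<Sum>a<A. C (j # e) a * monom 1 a) * u (j # e))"
    by (subst sum.reindex) (auto intro!: inj_onI simp: case_prod_unfold)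
  also have "\<dots> = (\<Sum>j<s. \<Sum>e\<in>E. (\<Sum>a<A. C (j # e) a * monom 1 a) * u (j # e))"
    by (rule sum.cartesian_product[symmetric])
  also have "\<dots> = (\<Sum>j<s. t ^ (g * j) * P j)"
    unfolding P_def sum_distrib_left by (intro sum.cong refl) (simp add: u_Cons mult_ac)
  finally have PS: "(\<Sum>j<s. t ^ (g * j) * P j) = 0" using C(2) by simp
  show "t ^ CHAR('a) dvd C e1 a1"
  proof (rule ccontr)
    assume nd: "\<not> t ^ CHAR('a) dvd C e1 a1"
    define Q where "Q j \<longleftrightarrow> j < s \<and> (\<exists>e\<in>E. \<exists>a<A. \<not> T dvd C (j # e) a)" for j
    have "\<exists>j. Q j" using nd C(3,4) by (auto simp: Q_def T_def)
    then obtain j0 where j0: "Q j0" "\<And>j. j < j0 \<Longrightarrow> \<not> Q j"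
      by (metis exists_least_iff)
    obtain e0 a0 where e0: "e0 \<in> E" "a0 < A" "\<not> T dvd C (j0 # e0) a0" and j0s: "j0 < s"
      using j0(1) by (auto simp: Q_def)
    have le: "g * j0 + g \<le> CHAR('a)"
    proof -
      have "g * j0 + g = Suc j0 * g" by simp
      also have "\<dots> \<le> s * g" using j0s by (intro mult_right_mono) auto
      finally show ?thesis using s by simp
    qed
    have gT: "t ^ (g * j0 + g) dvd T" unfolding T_def by (rule le_imp_power_dvd[OF le])
    have "t ^ (g * j0 + g) dvd t ^ (g * j) * P j" if j: "j < s" "j \<noteq> j0" for j
    proof (cases "j < j0")
      case True
      hence "T dvd C (j # e) a" if "e \<in> E" "a < A" for e a
        using j0(2)[OF True] j that by (auto simp: Q_def)
      hence "T dvd P j" unfolding P_def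
        by (intro dvd_sum dvd_mult2) auto
      thus ?thesis using gT by (meson dvd_mult dvd_trans)
    next
      case False
      hence "Suc j0 \<le> j" using j by simp
      hence "g * Suc j0 \<le> g * j" by (rule mult_left_mono) simp
      thus ?thesis by (intro dvd_mult2 le_imp_power_dvd) (simp add: add.commute)
    qed
    hence "t ^ (g * j0 + g) dvd (\<Sum>j\<in>{..<s} - {j0}. t ^ (g * j) * P j)"
      by (intro dvd_sum) auto
    moreover have "(\<Sum>j\<in>{..<s} - {j0}. t ^ (g * j) * P j) = - (t ^ (g * j0) * P j0)"
      using PS j0s by (subst (asm) sum.remove[of _ j0]) (auto simp: add_eq_0_iff)
    ultimately have "t ^ (g * j0) * t ^ g dvd t ^ (g * j0) * P j0"
      by (simp add: power_add)
    hence P0: "t ^ g dvd P j0" using t(2) by (subst (asm) dvd_times_left_cancel_iff) auto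
    \<comment> \<open>Reducing the coefficients modulo \<open>T\<close> changes \<open>P j0\<close>
      by a multiple of \<open>t ^ g\<close> only, and leaves scalars, so that each
      \<open>b e\<close> has degree below \<open>A\<close>.\<close>
    define \<rho> where "\<rho> e a = C (j0 # e) a mod T" for e a
    define b where "b e = (\<Sum>a<A. \<rho> e a * monom 1 a)" for e
    have "degree (\<rho> e a) = 0" if "e \<in> E" "a < A" for e a
      unfolding \<rho>_def T_def using C(1)[of "j0 # e" a] that assms(1) t j0s
      by (intro const_div_mod_power_char) auto
    hence \<rho>: "\<rho> e a = [:coeff (\<rho> e a) 0:]" if "e \<in> E" "a < A" for e a
      using that by (simp add: degree_0_id)
    have b': "b e = (\<Sum>a<A. monom (coeff (\<rho> e a) 0) a)" if "e \<in> E" for e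
      unfolding b_def by (intro sum.cong refl, subst \<rho>) (use that in \<open>auto simp: smult_monom\<close>)
    have degb: "degree (b e) < A" if "e \<in> E" for e
      unfolding b'[OF that] using e0 by (intro degree_sum_less) (auto intro: le_less_trans[OF degree_monom_le])
    have "b e0 \<noteq> 0"
    proof
      assume "b e0 = 0"
      hence "coeff (b e0) a0 = 0" by simp
      hence "coeff (\<rho> e0 a0) 0 = 0" using e0 by (simp add: b' coeff_sum)
      hence "\<rho> e0 a0 = 0" using \<rho> e0 by (metis pCons_0_0)
      thus False using e0 by (simp add: \<rho>_def dvd_eq_mod_eq_0)
    qed
    moreover have "t ^ g dvd (\<Sum>e\<in>E. b e * u e)"
    proof -
      have "t ^ g dvd T" using gT by (metis dvd_trans le_add2 le_imp_power_dvd)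
      have "(\<Sum>e\<in>E. b e * u e) - P j0 =
          (\<Sum>e\<in>E. (\<Sum>a<A. (\<rho> e a - C (j0 # e) a) * monom 1 a) * u e)"
        unfolding P_def b_def sum_subtractf[symmetric] left_diff_distrib[symmetric] by (rule refl)
      moreover have "T dvd \<rho> e a - C (j0 # e) a" for e a
        by (simp add: \<rho>_def flip: mod_eq_dvd_iff)
      ultimately have "T dvd (\<Sum>e\<in>E. b e * u e) - P j0" by (simp only:) (intro dvd_sum dvd_mult2)
      hence "t ^ g dvd (\<Sum>e\<in>E. b e * u e) - P j0" using \<open>t ^ g dvd T\<close> by (rule dvd_trans[rotated])
      thus ?thesis using P0 by (metis diff_add_cancel dvd_add)
    qed
    ultimately have "g \<le> card E * (A - 1 + (card E - 1) * (d - 1)) + (card E - 1)"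
      using power_dvd_exponent_bound[where E = E and u = u and \<Phi> = \<Phi> and \<eta> = \<eta> and t = t and b = b and A = A
          and d = d and g = g and ?e0.0 = e0] assms degb e0(1) by blast
    thus False using g by simp
  qed
qed (use assms in auto)

section \<open>Products of powers of several linear polynomials\<close>

text \<open>The head of a list of length \<open>i + 1\<close> is the exponent of the factor with index \<open>i\<close>.\<close>

primrec exponent_lists :: "(nat \<Rightarrow> nat) \<Rightarrow> nat \<Rightarrow> nat list set" where
  "exponent_lists s 0 = {[]}"
| "exponent_lists s (Suc i) = (\<lambda>(j, e). j # e) ` ({..<s i} \<times> exponent_lists s i)"

primrec power_prod :: "(nat \<Rightarrow> 'a::comm_semiring_1) \<Rightarrow> nat \<Rightarrow> nat list \<Rightarrow> 'a" where
  "power_prod f g [] = 1"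
| "power_prod f g (j # e) = f (length e) ^ (g * j) * power_prod f g e"

lemma finite_exponent_lists: "finite (exponent_lists s i)"
  by (induction i) auto

lemma card_exponent_lists: "card (exponent_lists s i) = (\<Prod>m<i. s m)"
proof (induction i)
  case (Suc i)
  have "card (exponent_lists s (Suc i)) = card ({..<s i} \<times> exponent_lists s i)"
    by (simp, intro card_image) (auto intro!: inj_onI)
  thus ?case using Suc by (simp add: card_cartesian_product)
qed simp

lemma length_exponent_lists: "e \<in> exponent_lists s i \<Longrightarrow> length e = i"
  by (induction i arbitrary: e) auto

lemma degree_linear_prod:
  fixes f :: "nat \<Rightarrow> 'a::idom poly"
  assumes "\<And>m. m < i \<Longrightarrow> degree (f m) = 1"
  shows "degree (\<Prod>m<i. f m) = i"
proof -
  have "degree (\<Prod>m<i. f m) = (\<Sum>m<i. degree (f m))"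
    using assms by (intro degree_prod_eq_sum_degree) force
  thus ?thesis using assms by simp
qed

text \<open>The logarithmic derivative is a sum of terms constant / \<open>f m\<close>; over the
  common denominator its numerator has degree below \<open>i\<close>, whatever the exponents are.
  The alternative \<open>\<eta> = 0\<close> covers \<open>i = 0\<close>.\<close>

lemma power_prod_log_deriv:
  fixes f :: "nat \<Rightarrow> 'a::idom poly"
  assumes "e \<in> exponent_lists s i" "\<And>m. m < i \<Longrightarrow> degree (f m) = 1"
  shows "\<exists>\<eta>. (\<eta> = 0 \<or> degree \<eta> < i) \<and>
    (\<Prod>m<i. f m) * pderiv (power_prod f g e) = \<eta> * power_prod f g e"
  using assms
proof (induction i arbitrary: e)
  case 0
  thus ?case by auto
next
  case (Suc i)
  then obtain j e' where e: "e = j # e'" "j < s i" "e' \<in> exponent_lists s i" by auto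
  define \<Phi> where "\<Phi> = (\<Prod>m<i. f m)"
  obtain \<eta> where \<eta>: "\<eta> = 0 \<or> degree \<eta> < i" "\<Phi> * pderiv (power_prod f g e') = \<eta> * power_prod f g e'"
    using Suc.IH[OF e(3)] Suc.prems unfolding \<Phi>_def by auto
  define P where "P = power_prod f g e'"
  define \<eta>' where "\<eta>' = f i * \<eta> + of_nat (g * j) * pderiv (f i) * \<Phi>"
  have "(\<Prod>m<Suc i. f m) * pderiv (f i ^ (g * j) * P)
      = f i ^ (g * j) * f i * (\<Phi> * pderiv P) + \<Phi> * P * (f i * pderiv (f i ^ (g * j)))"
    by (simp only: \<Phi>_def prod.lessThan_Suc pderiv_mult) (simp add: algebra_simps)
  also have "\<dots> = \<eta>' * (f i ^ (g * j) * P)"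
    unfolding \<eta>(2)[folded P_def] mult_pderiv_power \<eta>'_def by (simp only: algebra_simps)
  finally have 1: "(\<Prod>m<Suc i. f m) * pderiv (power_prod f g e) = \<eta>' * power_prod f g e"
    using length_exponent_lists[OF e(3)] by (simp add: e(1) P_def)
  have "degree (f i * \<eta>) < Suc i"
  proof (cases "\<eta> = 0")
    case False
    thus ?thesis using \<eta>(1) degree_mult_le[of "f i" \<eta>] Suc.prems(2)[of i] by simp
  qed simp
  moreover have "degree (of_nat (g * j) * pderiv (f i) * \<Phi>) < Suc i"
  proof -
    have "degree (of_nat (g * j) * pderiv (f i)) \<le> 0"
      using degree_mult_le[of "of_nat (g * j)" "pderiv (f i)"] degree_pderiv_bound[of "f i"]
        Suc.prems(2)[OF lessI] degree_of_nat[of "g * j", where 'a = 'a] by linarith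
    moreover have "degree \<Phi> = i"
      unfolding \<Phi>_def using Suc.prems(2) by (intro degree_linear_prod) auto
    ultimately show ?thesis
      using degree_mult_le[of "of_nat (g * j) * pderiv (f i)" \<Phi>] by simp
  qed
  ultimately have "degree \<eta>' < Suc i" unfolding \<eta>'_def by (rule degree_add_less)
  thus ?case using 1 by blast
qed

lemma not_dvd_power_prod:
  fixes t :: "'a::comm_semiring_1"
  assumes "prime_elem t" "\<And>m. m < length e \<Longrightarrow> \<not> t dvd f m"
  shows "\<not> t dvd power_prod f g e"
  using assms(2)
proof (induction e)
  case Nil
  thus ?case using assms(1) by (simp add: prime_elem_not_unit)
next
  case (Cons j e)
  thus ?case using assms(1)
    by (auto simp: prime_elem_dvd_mult_iff dest!: prime_elem_dvd_power)
qed

lemma prime_elem_linear: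
  fixes t :: "'a::field poly"
  assumes "degree t = 1"
  shows "prime_elem t"
proof -
  obtain a b where "t = [:a, b:]" "b \<noteq> 0"
    using assms by (metis degree1_coeffs)
  thus ?thesis by (simp add: prime_elem_linear_field_poly)
qed

text \<open>The factors are adjoined in the order of their indices. The lower bound on
  \<open>g\<close> at stage \<open>m\<close> involves only the exponent lists of the factors before
  \<open>m\<close>, so the range \<open>s m\<close> of the factor being adjoined is limited by
  \<open>s m * g \<le> CHAR('a)\<close> alone.\<close>

lemma const_indep_power_prod:
  fixes f :: "nat \<Rightarrow> 'a::field poly"
  assumes "CHAR('a) > 1" "A \<le> CHAR('a)"
    and f: "\<And>m. m < w \<Longrightarrow> degree (f m) = 1"
    and dist: "\<And>m m'. m < m' \<Longrightarrow> m' < w \<Longrightarrow> \<not> f m' dvd f m"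
    and s: "\<And>m. m < w \<Longrightarrow> s m * g \<le> CHAR('a)"
    and g: "\<And>m. m < w \<Longrightarrow> card (exponent_lists s m) * (A - 1 + (card (exponent_lists s m) - 1) * (m - 1)) + (card (exponent_lists s m) - 1) < g"
    and "i \<le> w"
  shows "const_indep A (exponent_lists s i) (power_prod f g)"
  using \<open>i \<le> w\<close>
proof (induction i)
  case 0
  show ?case unfolding exponent_lists.simps using assms by (intro const_indep_singleton) auto
next
  case (Suc i)
  have "\<forall>e\<in>exponent_lists s i. \<exists>\<eta>. (\<eta> = 0 \<or> degree \<eta> < i) \<and>
    (\<Prod>m<i. f m) * pderiv (power_prod f g e) = \<eta> * power_prod f g e"
    using power_prod_log_deriv[of _ s i f g] f Suc.prems by auto
  then obtain \<eta> where \<eta>: "\<And>e. e \<in> exponent_lists s i \<Longrightarrow> \<eta> e = 0 \<or> degree (\<eta> e) < i"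
    "\<And>e. e \<in> exponent_lists s i \<Longrightarrow> (\<Prod>m<i. f m) * pderiv (power_prod f g e) = \<eta> e * power_prod f g e"
    by metis
  have prime: "prime_elem (f i)" using f Suc.prems by (intro prime_elem_linear) auto
  have d: "degree (\<Prod>m<i. f m) = i" using f Suc.prems by (intro degree_linear_prod) auto
  show ?case unfolding exponent_lists.simps
  proof (rule const_indep_extend[where \<Phi> = "\<Prod>m<i. f m" and \<eta> = \<eta> and d = i and t = "f i" and g = g])
    show "degree (\<eta> e) \<le> i - 1" if "e \<in> exponent_lists s i" for e using \<eta>(1)[OF that] by auto
    have "f m \<noteq> 0" if "m < i" for m using f[of m] that Suc.prems by auto
    thus "(\<Prod>m<i. f m) \<noteq> 0" by simp
    show "\<not> f i dvd power_prod f g e" if "e \<in> exponent_lists s i" for e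
      using length_exponent_lists[OF that] dist Suc.prems by (intro not_dvd_power_prod prime) auto
    show "power_prod f g (j # e) = f i ^ (g * j) * power_prod f g e" if "e \<in> exponent_lists s i" for j e
      using length_exponent_lists[OF that] by simp
  qed (use Suc assms \<eta> prime d finite_exponent_lists in auto)
qed

section \<open>The auxiliary polynomial\<close>

lemma homogeneous_system_nontrivial_solution:
  fixes M :: "'y \<Rightarrow> 'x \<Rightarrow> 'a::field"
  assumes "finite X" "finite Y" "card Y < card X"
  shows "\<exists>\<alpha>. (\<exists>x\<in>X. \<alpha> x \<noteq> 0) \<and> (\<forall>y\<in>Y. (\<Sum>x\<in>X. M y x * \<alpha> x) = 0)"
proof -
  define n m where "n = card X" and "m = card Y"
  have mn: "m < n" using assms by (simp add: n_def m_def)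
  obtain h where h: "bij_betw h {..<n} X"
    using assms by (metis n_def bij_betw_from_nat_into_finite)
  obtain k where k: "bij_betw k {..<m} Y"
    using assms by (metis m_def bij_betw_from_nat_into_finite)
  \<comment> \<open>Zero rows make the system square. Row \<open>m\<close> is one of them, so every
    term of the determinant contains a zero.\<close>
  define B where "B = Matrix.mat n n (\<lambda>(i, j). if i < m then M (k i) (h j) else 0)"
  have B: "B \<in> carrier_mat n n" by (simp add: B_def)
  have "det B = 0" unfolding det_def'[OF B]
  proof (intro sum.neutral ballI)
    fix \<pi> assume "\<pi> \<in> {p. p permutes {0..<n}}"
    hence "\<pi> m < n" using mn by (auto dest: permutes_in_image[where x = m])
    hence "B $$ (m, \<pi> m) = 0" using mn by (simp add: B_def)
    thus "signof \<pi> * (\<Prod>i = 0..<n. B $$ (i, \<pi> i)) = 0"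
      using mn by (auto intro!: prod_zero bexI[of _ m])
  qed
  then obtain v where v: "v \<in> carrier_vec n" "v \<noteq> 0\<^sub>v n" "B *\<^sub>v v = 0\<^sub>v n"
    using det_0_iff_vec_prod_zero[OF B] by blast
  then obtain j0 where j0: "j0 < n" "v $ j0 \<noteq> 0"
    by (metis carrier_vecD eq_vecI index_zero_vec)
  define \<alpha> where "\<alpha> x = v $ the_inv_into {..<n} h x" for x
  have \<alpha>: "\<alpha> (h j) = v $ j" if "j < n" for j
    using h that by (auto simp: \<alpha>_def bij_betw_def the_inv_into_f_f)
  have "(\<Sum>x\<in>X. M y x * \<alpha> x) = 0" if "y \<in> Y" for y
  proof -
    obtain i where i: "i < m" "y = k i" using bij_betw_imp_surj_on[OF k] \<open>y \<in> Y\<close> by blast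
    have "(\<Sum>x\<in>X. M y x * \<alpha> x) = (\<Sum>j<n. M (k i) (h j) * \<alpha> (h j))"
      unfolding i(2) by (rule sum.reindex_bij_betw[OF h, symmetric])
    also have "\<dots> = (\<Sum>j<n. M (k i) (h j) * v $ j)"
      by (intro sum.cong refl) (simp add: \<alpha>)
    also have "\<dots> = (B *\<^sub>v v) $ i"
      using v(1) i mn by (simp add: B_def scalar_prod_def atLeast0LessThan)
    also have "\<dots> = 0" using i mn by (simp add: v(3))
    finally show ?thesis .
  qed
  moreover have "h j0 \<in> X" "\<alpha> (h j0) \<noteq> 0"
    using h j0 \<alpha> by (auto simp: bij_betw_def)
  ultimately show ?thesis by blast
qed

lemma poly_higher_pderiv_power:
  fixes G :: "'a::idom poly"
  shows "poly ((pderiv ^^ m) ([:- v, 1:] ^ m * G)) v = of_nat (fact m) * poly G v"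
proof (induction m arbitrary: G)
  case (Suc m)
  define t where "t = [:- v, 1:]"
  have "pderiv (t ^ Suc m * G) = t ^ m * (of_nat (Suc m) * G + t * pderiv G)"
    unfolding pderiv_mult pderiv_power_Suc
    by (simp add: t_def pderiv_pCons of_nat_poly algebra_simps)
  moreover have "(pderiv ^^ Suc m) (t ^ Suc m * G) = (pderiv ^^ m) (pderiv (t ^ Suc m * G))"
    by (simp add: funpow_swap1)
  ultimately have "poly ((pderiv ^^ Suc m) (t ^ Suc m * G)) v
      = of_nat (fact m) * poly (of_nat (Suc m) * G + t * pderiv G) v"
    using Suc.IH by (simp add: t_def)
  thus ?case by (simp add: t_def algebra_simps)
qed simp

text \<open>At a zero of exact order \<open>m\<close> the \<open>m\<close>-th derivative is
  \<open>fact m\<close> times a nonzero value. The bound \<open>L \<le> CHAR('a)\<close> keeps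
  \<open>fact m\<close> from vanishing for \<open>m < L\<close>.\<close>

lemma order_ge_if_higher_pderiv:
  fixes F :: "'a::idom poly"
  assumes "F \<noteq> 0" "L \<le> CHAR('a)" "\<And>l. l < L \<Longrightarrow> poly ((pderiv ^^ l) F) v = 0"
  shows "order v F \<ge> L"
proof (rule ccontr)
  assume *: "\<not> order v F \<ge> L"
  define m where "m = order v F"
  have m: "m < L" using * by (simp add: m_def)
  obtain G where G: "F = [:- v, 1:] ^ m * G" "\<not> [:- v, 1:] dvd G"
    using order_decomp[OF assms(1)] unfolding m_def by blast
  have "poly G v \<noteq> 0" using G(2) by (simp add: poly_eq_0_iff_dvd)
  moreover have "of_nat (fact m) * poly G v = 0"
    using assms(3)[OF m] unfolding G(1) poly_higher_pderiv_power .
  ultimately have "of_nat (fact m) = (0 :: 'a)" by simp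
  hence "CHAR('a) dvd fact m" by (simp only: of_nat_eq_0_iff_char_dvd)
  moreover have "prime CHAR('a)" using m assms(2) by (intro prime_CHAR_semidom) auto
  ultimately show False using m assms(2) by (simp add: prime_dvd_fact_iff)
qed

text \<open>The auxiliary polynomial is a combination of the x^(p i) x^a \<open>u e\<close>. At
  points of \<open>V\<close> one has v^p = v and \<open>u e\<close> = 1, so
  \<open>\<Phi> ^ l\<close> times its \<open>l\<close>-th derivative agrees there with a polynomial
  of degree below \<open>A - 1 + l * (d - 1) + J\<close>. Forcing all coefficients of these
  polynomials to vanish is a linear system with fewer equations than unknowns;
  \<open>const_indep\<close> ensures that a nontrivial solution gives a nonzero polynomial.\<close>

lemma stepanov_card_bound:
  fixes u \<eta> :: "'e \<Rightarrow> 'a::field poly" and V :: "'a set"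
  assumes p: "CHAR('a) > 1" and "finite E" "const_indep A E u" "A > 0" "J > 0"
    and u: "\<And>e. e \<in> E \<Longrightarrow> \<Phi> * pderiv (u e) = \<eta> e * u e"
    and deg: "\<And>e. e \<in> E \<Longrightarrow> degree (\<eta> e) \<le> d - 1" "degree \<Phi> \<le> d"
    and D: "\<And>e. e \<in> E \<Longrightarrow> degree (u e) \<le> D"
    and V: "\<And>v. v \<in> V \<Longrightarrow> v ^ CHAR('a) = v" "\<And>v. v \<in> V \<Longrightarrow> poly \<Phi> v \<noteq> 0"
      "\<And>v e. v \<in> V \<Longrightarrow> e \<in> E \<Longrightarrow> poly (u e) v = 1"
    and count: "(\<Sum>l<L. A - 1 + l * (d - 1) + J) < card E * (J * A)"
    and "L \<le> CHAR('a)"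
  shows "card V * L \<le> A - 1 + CHAR('a) * (J - 1) + D"
proof -
  define X where "X = E \<times> {..<J} \<times> {..<A}"
  define Y where "Y = Sigma {..<L} (\<lambda>l. {..<A - 1 + l * (d - 1) + J})"
  define W where "W l e i a = twisted_deriv \<Phi> (\<eta> e) l (monom 1 a) * monom 1 i" for l e i a
  have "finite X" "finite Y" "card Y < card X"
    using assms(2) count by (simp_all add: X_def Y_def card_cartesian_product)
  from homogeneous_system_nontrivial_solution[OF this, of "\<lambda>(l, r) (e, i, a). coeff (W l e i a) r"]
  obtain \<alpha> where \<alpha>: "\<exists>x\<in>X. \<alpha> x \<noteq> 0"
    "\<And>l r. (l, r) \<in> Y \<Longrightarrow> (\<Sum>(e, i, a)\<in>X. coeff (W l e i a) r * \<alpha> (e, i, a)) = 0"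
    by (force simp: case_prod_unfold)
  have sum_X: "(\<Sum>(e, i, a)\<in>X. G e i a) = (\<Sum>e\<in>E. \<Sum>a<A. \<Sum>i<J. G e i a)" for G :: "'e \<Rightarrow> nat \<Rightarrow> nat \<Rightarrow> 'b::comm_monoid_add"
  proof -
    have "(\<Sum>(e, i, a)\<in>X. G e i a) = (\<Sum>e\<in>E. \<Sum>i<J. \<Sum>a<A. G e i a)"
      unfolding X_def by (simp add: sum.cartesian_product case_prod_unfold)
    thus ?thesis by (simp add: sum.swap[of _ "{..<J}"])
  qed
  define C where "C e a = (\<Sum>i<J. monom (\<alpha> (e, i, a)) (CHAR('a) * i))" for e a
  define F where "F = (\<Sum>e\<in>E. (\<Sum>a<A. C e a * monom 1 a) * u e)"
  have C': "pderiv (C e a) = 0" for e a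
    by (simp add: C_def pderiv_sum pderiv_monom)
  have "F \<noteq> 0"
  proof
    assume "F = 0"
    obtain e i a where x: "e \<in> E" "i < J" "a < A" "\<alpha> (e, i, a) \<noteq> 0"
      using \<alpha>(1) by (auto simp: X_def)
    have "C e a = 0" using const_indepD[where C = C, OF assms(3) C' _ x(1,3)] \<open>F = 0\<close> unfolding F_def by blast
    moreover have "coeff (C e a) (CHAR('a) * i) = \<alpha> (e, i, a)"
      using p x(2) by (simp add: C_def coeff_sum)
    ultimately show False using x by simp
  qed
  have vanish: "poly ((pderiv ^^ l) F) v = 0" if l: "l < L" and v: "v \<in> V" for l v
  proof -
    define G where "G = (\<Sum>(e, i, a)\<in>X. smult (\<alpha> (e, i, a)) (W l e i a))"
    have "coeff G r = 0" for r
    proof (cases "(l, r) \<in> Y")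
      case True
      thus ?thesis using \<alpha>(2)[OF True] by (simp add: G_def coeff_sum case_prod_unfold mult.commute)
    next
      case False
      hence r: "r \<ge> A - 1 + l * (d - 1) + J" using l by (simp add: Y_def)
      have "coeff (W l e i a) r = 0" if "(e, i, a) \<in> X" for e i a
      proof (rule coeff_eq_0)
        have "degree (twisted_deriv \<Phi> (\<eta> e) l (monom 1 a)) \<le> (A - 1) + l * (d - 1)"
          using that deg by (intro degree_twisted_deriv) (auto simp: X_def degree_monom_eq)
        moreover have "degree (monom 1 i :: 'a poly) \<le> J - 1" "i < J"
          using that by (auto simp: X_def degree_monom_eq)
        ultimately show "degree (W l e i a) < r"
          unfolding W_def using degree_mult_le[of "twisted_deriv \<Phi> (\<eta> e) l (monom 1 a)" "monom 1 i"] r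
          by linarith
      qed
      thus ?thesis by (auto simp: G_def coeff_sum case_prod_unfold intro!: sum.neutral)
    qed
    hence G0: "G = 0" by (simp add: poly_eq_iff)
    have powp: "v ^ (CHAR('a) * i) = v ^ i" for i using V(1)[OF v] by (simp add: power_mult)
    have Cv: "poly (C e a) v = (\<Sum>i<J. \<alpha> (e, i, a) * v ^ i)" for e a
      by (simp add: C_def poly_sum poly_monom powp)
    have Fd: "(pderiv ^^ l) F = (\<Sum>e\<in>E. \<Sum>a<A. C e a * (pderiv ^^ l) (monom 1 a * u e))"
      unfolding F_def sum_distrib_right higher_pderiv_sum mult.assoc
      by (simp only: higher_pderiv_const_mult[OF C'])
    have "poly \<Phi> v ^ l * poly ((pderiv ^^ l) F) v = (\<Sum>e\<in>E. \<Sum>a<A. poly (C e a) v * poly (\<Phi> ^ l * (pderiv ^^ l) (monom 1 a * u e)) v)"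
      unfolding Fd by (simp add: poly_sum sum_distrib_left poly_power mult_ac)
    also have "\<dots> = (\<Sum>e\<in>E. \<Sum>a<A. poly (C e a) v * poly (twisted_deriv \<Phi> (\<eta> e) l (monom 1 a)) v)"
      using V(3)[OF v] by (intro sum.cong refl) (simp add: higher_pderiv_twisted_deriv[OF u])
    also have "\<dots> = (\<Sum>e\<in>E. \<Sum>a<A. \<Sum>i<J. poly (smult (\<alpha> (e, i, a)) (W l e i a)) v)"
      unfolding Cv sum_distrib_right
      by (intro sum.cong refl) (simp add: W_def poly_monom mult_ac)
    also have "\<dots> = poly G v"
      unfolding G_def by (simp add: poly_sum case_prod_unfold flip: sum_X)
    finally show ?thesis using V(2)[OF v] by (simp add: G0)
  qed
  have "degree F \<le> A - 1 + CHAR('a) * (J - 1) + D" unfolding F_def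
  proof (intro degree_sum_le assms(2))
    fix e assume e: "e \<in> E"
    have "degree (C e a * monom 1 a) \<le> CHAR('a) * (J - 1) + (A - 1)" if "a < A" for a
    proof -
      have "degree (C e a) \<le> CHAR('a) * (J - 1)" unfolding C_def
        by (intro degree_sum_le) (auto intro!: order.trans[OF degree_monom_le])
      moreover have "degree (monom 1 a :: 'a poly) \<le> A - 1" using that by (simp add: degree_monom_eq)
      ultimately show ?thesis using degree_mult_le[of "C e a" "monom 1 a"] by linarith
    qed
    hence "degree (\<Sum>a<A. C e a * monom 1 a) \<le> CHAR('a) * (J - 1) + (A - 1)"
      by (intro degree_sum_le) auto
    thus "degree ((\<Sum>a<A. C e a * monom 1 a) * u e) \<le> A - 1 + CHAR('a) * (J - 1) + D"
      using degree_mult_le[of "\<Sum>a<A. C e a * monom 1 a" "u e"] D[OF e] by linarith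
  qed
  moreover have "card V * L \<le> degree F"
  proof (cases "L = 0")
    case False
    have roots: "finite {v. poly F v = 0}" using \<open>F \<noteq> 0\<close> by (rule poly_roots_finite)
    have sub: "V \<subseteq> {v. poly F v = 0}" using vanish[of 0] False by auto
    have "card V * L = (\<Sum>v\<in>V. L)" by simp
    also have "\<dots> \<le> (\<Sum>v\<in>V. order v F)"
      using order_ge_if_higher_pderiv[OF \<open>F \<noteq> 0\<close> \<open>L \<le> CHAR('a)\<close>] vanish by (intro sum_mono) auto
    also have "\<dots> \<le> (\<Sum>v | poly F v = 0. order v F)"
      using roots sub by (intro sum_mono2) auto
    also have "\<dots> \<le> degree F" using \<open>F \<noteq> 0\<close> by (rule sum_order_le_degree)
    finally show ?thesis .
  qed simp
  ultimately show ?thesis by linarith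
qed

lemma degree_power_prod:
  fixes f :: "nat \<Rightarrow> 'a::idom poly"
  assumes "e \<in> exponent_lists s i" "\<And>m. m < i \<Longrightarrow> degree (f m) = 1"
  shows "degree (power_prod f g e) \<le> g * (\<Sum>m<i. s m - 1)"
  using assms
proof (induction i arbitrary: e)
  case (Suc i)
  then obtain j e' where e: "e = j # e'" "j < s i" "e' \<in> exponent_lists s i" by auto
  have "degree (power_prod f g e) \<le> degree (f i ^ (g * j)) + degree (power_prod f g e')"
    using degree_mult_le length_exponent_lists[OF e(3)] by (simp add: e(1))
  also have "degree (f i ^ (g * j)) = g * j"
    using Suc.prems(2)[OF lessI] by (rule degree_linear_power)
  also have "\<dots> \<le> g * (s i - 1)" using e(2) by (intro mult_left_mono) auto
  also have "degree (power_prod f g e') \<le> g * (\<Sum>m<i. s m - 1)"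
    using Suc.IH[OF e(3)] Suc.prems(2) by auto
  finally show ?case by (simp add: algebra_simps)
qed simp

text \<open>With the linear polynomials 1 - \<open>c i\<close> x, every product of their
  \<open>g\<close>-th powers equals 1 on \<open>V\<close>. The hypothesis \<open>count\<close> says
  that unknowns outnumber equations, and \<open>indep\<close> that \<open>g\<close> exceeds the
  determinant bound at every stage.\<close>

lemma stepanov_card_bound_linear_factors:
  fixes c :: "nat \<Rightarrow> 'a::field" and V :: "'a set" and p g k w A J L :: nat
  assumes p: "CHAR('a) = p" "p > 1" and gk: "g * k + 1 = p" "k \<ge> 2" and "w > 0"
    and c: "\<And>i. i < w \<Longrightarrow> c i \<noteq> 0" "inj_on c {..<w}"
    and V: "\<And>v. v \<in> V \<Longrightarrow> v ^ p = v" "\<And>v i. v \<in> V \<Longrightarrow> i < w \<Longrightarrow> (1 - c i * v) ^ g = 1"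
    and pos: "A > 0" "J > 0" "L > 0" "L \<le> p" "A \<le> p"
    and count: "2 * L * (A + J) + w * L * L \<le> 2 * (k * 2 ^ (w - 1) * J * A)"
    and indep: "2 ^ (w - 1) * A + 2 ^ (w - 1) * 2 ^ (w - 1) * w \<le> g"
  shows "card V * L \<le> A + p * J + g * w"
proof -
  define f where "f i = [:1, - c i:]" for i
  \<comment> \<open>All factors but the last take only the exponents 0 and \<open>g\<close>. The
    long range \<open>k\<close> is put last, where it does not enter the lower bound on
    \<open>g\<close> required for independence.\<close>
  define s where "s i = (if i = w - 1 then k else 2)" for i
  define E where "E = exponent_lists s w"
  have g: "g > 0" using p gk by (cases g) auto
  have f: "degree (f i) = 1" if "i < w" for i using c(1)[OF that] by (simp add: f_def)
  have card: "card (exponent_lists s m) = 2 ^ m" if "m < w" for m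
  proof -
    have "(\<Prod>i<m. s i) = (\<Prod>i<m. 2)" using that by (intro prod.cong) (auto simp: s_def)
    thus ?thesis by (simp add: card_exponent_lists)
  qed
  have "card E = (\<Prod>m<Suc (w - 1). s m)" unfolding E_def card_exponent_lists using \<open>w > 0\<close> by simp
  also have "\<dots> = 2 ^ (w - 1) * k" by (simp add: s_def)
  finally have cardE: "card E = k * 2 ^ (w - 1)" by simp
  have "const_indep A (exponent_lists s w) (power_prod f g)"
  proof (rule const_indep_power_prod[where w = w])
    fix m m' assume m: "m < m'" "m' < w"
    show "\<not> f m' dvd f m"
    proof
      assume "f m' dvd f m"
      then obtain h where "f m = f m' * h" by (elim dvdE)
      moreover have "poly (f m') (1 / c m') = 0" using c(1)[OF m(2)] by (simp add: f_def)
      ultimately have "poly (f m) (1 / c m') = 0" by (simp only: poly_mult mult_zero_left)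
      hence "c m = c m'" using c(1)[OF m(2)] by (simp add: f_def field_simps)
      thus False using c(2) m by (auto dest: inj_onD)
    qed
  next
    fix m assume m: "m < w"
    have "2 * g \<le> k * g" using gk by (intro mult_right_mono) auto
    moreover have "k * g \<le> CHAR('a)" using p gk by (simp add: mult.commute)
    ultimately have "2 * g \<le> CHAR('a)" "k * g \<le> CHAR('a)" by linarith+
    thus "s m * g \<le> CHAR('a)" by (simp add: s_def)
    define n where "n = (2::nat) ^ m"
    have n: "n \<ge> 1" "n \<le> 2 ^ (w - 1)" using m by (auto simp: n_def intro!: power_increasing)
    have "n * (A - 1 + (n - 1) * (m - 1)) + (n - 1) < n * A + n * n * w"
    proof -
      have "n * (A - 1) + n = n * A" using pos by (cases A) auto
      moreover have "n * ((n - 1) * (m - 1)) \<le> n * (n * w)"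
        using m by (intro mult_left_mono mult_mono) auto
      ultimately show ?thesis using n(1) by (simp add: algebra_simps)
    qed
    also have "\<dots> \<le> 2 ^ (w - 1) * A + 2 ^ (w - 1) * 2 ^ (w - 1) * w"
      using n(2) by (intro add_mono mult_mono) auto
    also note indep
    finally show "card (exponent_lists s m) * (A - 1 + (card (exponent_lists s m) - 1) * (m - 1)) + (card (exponent_lists s m) - 1) < g"
      using card[OF m] by (simp add: n_def)
  qed (use p pos f in auto)
  hence indepE: "const_indep A E (power_prod f g)" by (simp add: E_def)
  have "\<forall>e\<in>E. \<exists>\<eta>. (\<eta> = 0 \<or> degree \<eta> < w) \<and>
    (\<Prod>m<w. f m) * pderiv (power_prod f g e) = \<eta> * power_prod f g e"
    using power_prod_log_deriv[of _ s w f g] f by (auto simp: E_def)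
  then obtain \<eta> where \<eta>: "\<And>e. e \<in> E \<Longrightarrow> \<eta> e = 0 \<or> degree (\<eta> e) < w"
    "\<And>e. e \<in> E \<Longrightarrow> (\<Prod>m<w. f m) * pderiv (power_prod f g e) = \<eta> e * power_prod f g e"
    by metis
  have one: "poly (power_prod f g e) v = 1" if v: "v \<in> V" and "length e \<le> w" for v e
    using that(2)
  proof (induction e)
    case (Cons j e)
    thus ?case using V(2)[OF v, of "length e"] by (simp add: power_mult f_def mult.commute)
  qed simp
  have "card V * L \<le> A - 1 + CHAR('a) * (J - 1) + g * (\<Sum>m<w. s m - 1)"
  proof (rule stepanov_card_bound[where \<Phi> = "\<Prod>m<w. f m" and u = "power_prod f g" and E = E and \<eta> = \<eta> and d = w])
    show "degree (\<eta> e) \<le> w - 1" if "e \<in> E" for e using \<eta>(1)[OF that] \<open>w > 0\<close> by auto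
    show "degree (\<Prod>m<w. f m) \<le> w" using degree_linear_prod[of w f] f by simp
    show "degree (power_prod f g e) \<le> g * (\<Sum>m<w. s m - 1)" if "e \<in> E" for e
      using that f unfolding E_def by (intro degree_power_prod) auto
    show "poly (\<Prod>m<w. f m) v \<noteq> 0" if v: "v \<in> V" for v
    proof -
      have "poly (f m) v \<noteq> 0" if "m < w" for m
      proof
        assume "poly (f m) v = 0"
        hence "1 - c m * v = 0" by (simp add: f_def mult.commute)
        thus False using V(2)[OF v that] g by (simp add: power_0_left)
      qed
      thus ?thesis by (simp add: poly_prod)
    qed
    show "poly (power_prod f g e) v = 1" if "v \<in> V" "e \<in> E" for v e
      using one[OF that(1)] that(2) length_exponent_lists unfolding E_def by auto
    have sum_l: "2 * (\<Sum>l<L. l) = L * (L - 1)"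
      by (induction L) (auto simp: algebra_simps)
    have "2 * (\<Sum>l<L. a + l * m + J) = 2 * L * (a + J) + m * (2 * (\<Sum>l<L. l))" for a m
      by (induction L) (simp_all add: algebra_simps)
    from this[of "A - 1" "w - 1"]
    have "2 * (\<Sum>l<L. A - 1 + l * (w - 1) + J) = 2 * L * (A - 1 + J) + (w - 1) * (2 * (\<Sum>l<L. l))" .
    also have "2 * (\<Sum>l<L. l) = L * (L - 1)" by (rule sum_l)
    also have "2 * L * (A - 1 + J) + (w - 1) * (L * (L - 1)) < 2 * L * (A + J) + w * (L * L)"
      using pos by (intro add_less_le_mono mult_mono) auto
    finally show "(\<Sum>l<L. A - 1 + l * (w - 1) + J) < card E * (J * A)"
      using count unfolding cardE by (simp add: mult_ac)
  qed (use p V pos indepE \<eta> finite_exponent_lists in \<open>auto simp: E_def\<close>)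
  also have "(\<Sum>m<w. s m - 1) = (\<Sum>m<Suc (w - 1). s m - 1)" using \<open>w > 0\<close> by simp
  also have "\<dots> = (w - 1) + (k - 1)" by (simp add: s_def)
  \<comment> \<open>The part \<open>g * k\<close>, which is \<open>p - 1\<close>, is absorbed below
    by passing from \<open>p * (J - 1)\<close> to \<open>p * J\<close>.\<close>
  also have "g * ((w - 1) + (k - 1)) \<le> g * w + g * k" by (simp add: algebra_simps)
  also have "A - 1 + CHAR('a) * (J - 1) + (g * w + g * k) \<le> A + p * J + g * w"
    using gk pos p by (cases J) auto
  finally show ?thesis by simp
qed

section \<open>Counting quotients modulo a prime\<close>

lemma card_residue_class_le:
  fixes d H :: nat
  assumes "d > 0" "\<And>u v. u \<in> S \<Longrightarrow> v \<in> S \<Longrightarrow> u mod d = v mod d" "S \<subseteq> {1..H}"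
  shows "card S \<le> H div d + 1"
proof -
  have "inj_on (\<lambda>u. u div d) S"
    by (rule inj_onI) (metis assms(2) div_mult_mod_eq)
  moreover have "(\<lambda>u. u div d) ` S \<subseteq> {..H div d}"
    using assms(3) by (force intro: div_le_mono)
  ultimately have "card S \<le> card {..H div d}" by (intro card_inj_on_le) auto
  thus ?thesis by simp
qed

lemma card_multiples_le: "card {q\<in>{1..Q}. d dvd q} \<le> Q div d" if "d > 0" for d Q :: nat
proof -
  have "{q\<in>{1..Q}. d dvd q} \<subseteq> (\<lambda>i. d * i) ` {1..Q div d}"
  proof
    fix q assume q: "q \<in> {q\<in>{1..Q}. d dvd q}"
    then obtain i where i: "q = d * i" by blast
    hence "i \<in> {1..Q div d}"
      using q that by (auto simp: less_eq_div_iff_mult_less_eq mult.commute)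
    thus "q \<in> (\<lambda>i. d * i) ` {1..Q div d}" using i by blast
  qed
  hence "card {q\<in>{1..Q}. d dvd q} \<le> card ((\<lambda>i. d * i) ` {1..Q div d})"
    by (intro card_mono) auto
  also have "\<dots> \<le> Q div d" by (rule order.trans[OF card_image_le]) auto
  finally show ?thesis .
qed

text \<open>Telescoping after the exact first term 1/4. That the total stays below 1 is what leaves
  a positive proportion of coprime pairs in the union bound that follows.\<close>

lemma sum_inverse_squares_le: "(\<Sum>d=2..Q. 1 / real d ^ 2) \<le> 3 / 4"
proof (cases "Q \<ge> 2")
  case True
  hence "(\<Sum>d=2..Q. 1 / real d ^ 2) \<le> 3 / 4 - 1 / real Q"
  proof (induction Q rule: dec_induct)
    case (step n)
    have "1 / real (Suc n) ^ 2 \<le> 1 / (real n * real (Suc n))"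
      unfolding power2_eq_square using step by (intro divide_left_mono mult_right_mono) auto
    also have "\<dots> = 1 / real n - 1 / real (Suc n)"
      using step by (simp add: field_simps)
    finally show ?case using step by simp
  qed simp
  thus ?thesis by (rule order.trans) simp
qed simp

text \<open>A union bound over the value \<open>d\<close> of the gcd. The main terms take away at
  most 3/4 of all pairs, and the rounding in the count of \<open>u\<close> costs at most
  \<open>Q / 2\<close> for each \<open>d\<close>, which makes up the second term.\<close>

lemma card_coprime_pairs_ge:
  fixes a r :: int and H Q :: nat
  assumes "coprime a r"
  shows "real (card {(u, q) \<in> {1..H} \<times> {1..Q}. coprime (r + a * int u) (int q)})
    \<ge> real H * real Q / 4 - real Q ^ 2 / 2"
proof -
  define B where "B d = {u\<in>{1..H}. int d dvd r + a * int u} \<times> {q\<in>{1..Q}. d dvd q}" for d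
  define G where "G = {(u, q) \<in> {1..H} \<times> {1..Q}. coprime (r + a * int u) (int q)}"
  have cover: "{1..H} \<times> {1..Q} \<subseteq> G \<union> (\<Union>d\<in>{2..Q}. B d)"
  proof safe
    fix u q assume uq: "u \<in> {1..H}" "q \<in> {1..Q}" "(u, q) \<notin> (\<Union>d\<in>{2..Q}. B d)"
    show "(u, q) \<in> G"
    proof (rule ccontr)
      assume "(u, q) \<notin> G"
      hence nc: "gcd (r + a * int u) (int q) \<noteq> 1" using uq by (auto simp: G_def coprime_iff_gcd_eq_1)
      define d where "d = nat (gcd (r + a * int u) (int q))"
      have d: "int d = gcd (r + a * int u) (int q)" by (simp add: d_def)
      have "d \<noteq> 1" using nc d by auto
      moreover have "d dvd q" using d by (metis gcd_dvd2 int_dvd_int_iff)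
      moreover have "int d dvd r + a * int u" using d by simp
      moreover have "d \<noteq> 0" "d \<le> q" using \<open>d dvd q\<close> uq by (auto dest: dvd_imp_le)
      ultimately show False using uq by (auto simp: B_def)
    qed
  qed
  have cardB: "real (card (B d)) \<le> real Q / d * (real H / d + 1)" if d: "d \<in> {2..Q}" for d
  proof -
    have "card {u\<in>{1..H}. int d dvd r + a * int u} \<le> H div d + 1"
    proof (rule card_residue_class_le)
      fix u v assume uv: "u \<in> {u\<in>{1..H}. int d dvd r + a * int u}" "v \<in> {u\<in>{1..H}. int d dvd r + a * int u}"
      \<comment> \<open>Any common divisor of \<open>a\<close> and \<open>d\<close> also divides
        \<open>r\<close>; hence \<open>a\<close> is invertible modulo \<open>d\<close> and the
        admissible \<open>u\<close> form a single residue class.\<close>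
      have "coprime a (int d)"
      proof (rule coprimeI)
        fix x assume x: "x dvd a" "x dvd int d"
        have "int d dvd r + a * int u" using uv by simp
        with x(2) have "x dvd r + a * int u" by (rule dvd_trans)
        hence "x dvd r" using x(1) by (simp add: dvd_add_left_iff)
        thus "is_unit x" using coprime_common_divisor[OF assms x(1)] by simp
      qed
      moreover have "int d dvd a * (int u - int v)"
        using dvd_diff[of "int d" "r + a * int u" "r + a * int v"] uv by (simp add: algebra_simps)
      ultimately have "int d dvd int u - int v" by (simp add: coprime_dvd_mult_right_iff coprime_commute)
      thus "u mod d = v mod d" by (metis mod_eq_dvd_iff of_nat_eq_iff of_nat_mod)
    qed (use d in auto)
    moreover have "card {q\<in>{1..Q}. d dvd q} \<le> Q div d" using d by (intro card_multiples_le) auto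
    ultimately have "card (B d) \<le> (H div d + 1) * (Q div d)"
      unfolding B_def card_cartesian_product by (rule mult_mono) auto
    hence "real (card (B d)) \<le> real ((H div d + 1) * (Q div d))" by (rule of_nat_mono)
    also have "\<dots> = (real (H div d) + 1) * real (Q div d)"
      by (simp only: of_nat_mult of_nat_add of_nat_1)
    also have "\<dots> \<le> (real H / d + 1) * (real Q / d)"
      by (intro mult_mono add_mono of_nat_div_le_of_nat) auto
    finally show ?thesis by (simp add: mult.commute)
  qed
  have fin: "finite G" "finite (B d)" for d by (auto simp: G_def B_def intro: finite_subset[of _ "{1..H} \<times> {1..Q}"])
  have "H * Q = card ({1..H} \<times> {1..Q})" by simp
  also have "\<dots> \<le> card (G \<union> (\<Union>d\<in>{2..Q}. B d))" using fin cover by (intro card_mono) auto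
  also have "\<dots> \<le> card G + (\<Sum>d\<in>{2..Q}. card (B d))"
    using card_UN_le[of "{2..Q}" B] card_Un_le[of G "\<Union>d\<in>{2..Q}. B d"] by simp
  finally have "real (H * Q) \<le> real (card G + (\<Sum>d\<in>{2..Q}. card (B d)))" by (rule of_nat_mono)
  also have "\<dots> \<le> real (card G) + (\<Sum>d\<in>{2..Q}. real Q / d * (real H / d + 1))"
    using sum_mono[of "{2..Q}" "\<lambda>d. real (card (B d))", OF cardB] by simp
  also have "(\<Sum>d\<in>{2..Q}. real Q / d * (real H / d + 1)) \<le> (\<Sum>d\<in>{2..Q}. real Q * real H * (1 / real d ^ 2) + real Q / 2)"
    by (intro sum_mono) (auto simp: field_simps power2_eq_square)
  also have "\<dots> = real Q * real H * (\<Sum>d\<in>{2..Q}. 1 / real d ^ 2) + real (Q - 1) * (real Q / 2)"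
    by (simp add: sum.distrib sum_distrib_left)
  also have "\<dots> \<le> real Q * real H * (3 / 4) + real Q * (real Q / 2)"
    using sum_inverse_squares_le[of Q] by (intro add_mono mult_left_mono mult_right_mono) auto
  finally show ?thesis by (simp add: G_def field_simps power2_eq_square)
qed

text \<open>Only pairs with (r + a u) / q in lowest terms are counted, where r = a N - b p is the
  numerator of the approximation error: equal ratios then give equal reduced fractions. The
  hypothesis \<open>4 * Q ^ 2 * H \<le> p\<close> bounds a (u q' - u' q) by p/2.\<close>

lemma card_ratios_ge:
  fixes N :: int and p H Q :: nat
  assumes "prime p" "CHAR('a::field) = p" "Q > 0" "H > 0" "4 * Q ^ 2 * H \<le> p"
  shows "real (card ((\<lambda>(u, q). of_int (N + int u) / of_nat q :: 'a) ` ({1..H} \<times> {1..Q})))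
    \<ge> real H * real Q / 4 - real Q ^ 2 / 2"
proof -
  have p: "p > 1" using assms(1) by (rule prime_gt_1_nat)
  \<comment> \<open>Allowing denominators up to \<open>2 * Q\<close> makes |r| smaller than p / (2
    Q), so r (q' - q) stays below the other p/2.\<close>
  obtain b a where ba: "coprime b a" "0 < a" "a \<le> int (2 * Q)"
    "\<bar>of_int a * (of_int N / real p) - of_int b\<bar> < 1 / real (2 * Q)"
    using Dirichlet_approx_coprime[of "2 * Q" "of_int N / real p"] assms(3) by auto
  \<comment> \<open>Modulo \<open>p\<close>, \<open>a (N + u)\<close> is \<open>r + a u\<close>, and these integers are so small that congruence of
    cross products forces equality.\<close>
  define r where "r = a * N - b * int p"
  have "2 * real Q * \<bar>of_int r\<bar> < real p"
  proof -
    have "of_int r = real p * (of_int a * (of_int N / real p) - of_int b)"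
      using p by (simp add: r_def algebra_simps)
    hence "\<bar>of_int r\<bar> = real p * \<bar>of_int a * (of_int N / real p) - of_int b\<bar>"
      by (simp add: abs_mult)
    also have "\<dots> < real p * (1 / real (2 * Q))"
      using ba(4) p by (intro mult_strict_left_mono) auto
    finally show ?thesis using assms(3) by (simp add: field_simps)
  qed
  hence "real_of_int (2 * int Q * \<bar>r\<bar>) < real_of_int (int p)" by simp
  hence r: "2 * int Q * \<bar>r\<bar> < int p" by (simp only: of_int_less_iff)
  have "2 * Q < p"
  proof -
    have "Q * 1 \<le> Q * (Q * H)" using assms(3,4) by (intro mult_left_mono) auto
    moreover have "4 * (Q * (Q * H)) \<le> p" using assms(5) by (simp add: power2_eq_square mult_ac)
    ultimately show ?thesis using assms(3) by linarith
  qed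
  hence "\<not> int p dvd a" using ba(2,3) by (auto dest: zdvd_imp_le)
  hence "coprime a (int p)"
    using assms(1) prime_imp_coprime[of "int p" a] by (simp add: coprime_commute)
  hence "coprime a (b * int p)" using ba(1) by (simp add: coprime_commute)
  have cop: "coprime a r"
  proof (rule coprimeI)
    fix x assume x: "x dvd a" "x dvd r"
    have "b * int p = a * N - r" by (simp add: r_def)
    hence "x dvd b * int p" using x by simp
    thus "is_unit x" using \<open>coprime a (b * int p)\<close> x(1) by (meson coprime_common_divisor)
  qed
  define G where "G = {(u, q) \<in> {1..H} \<times> {1..Q}. coprime (r + a * int u) (int q)}"
  have "inj_on (\<lambda>(u, q). of_int (N + int u) / of_nat q :: 'a) G"
  proof (rule inj_onI, clarify)
    fix u q u' q'
    assume uq: "(u, q) \<in> G" "(u', q') \<in> G"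
      and eq: "of_int (N + int u) / of_nat q = (of_int (N + int u') / of_nat q' :: 'a)"
    have q: "0 < q" "q \<le> Q" "0 < q'" "q' \<le> Q" "u \<le> H" "u' \<le> H" using uq by (auto simp: G_def)
    have nz: "of_nat q \<noteq> (0 :: 'a)" "of_nat q' \<noteq> (0 :: 'a)"
      using q \<open>2 * Q < p\<close> assms(2) by (auto simp: of_nat_eq_0_iff_char_dvd dest: dvd_imp_le)
    have "of_int ((N + int u) * int q') = (of_int ((N + int u') * int q) :: 'a)"
      using eq nz by (simp add: field_simps)
    hence "int p dvd (N + int u) * int q' - (N + int u') * int q"
      by (simp only: of_int_eq_iff_cong_CHAR cong_iff_dvd_diff assms(2))
    hence "int p dvd a * ((N + int u) * int q' - (N + int u') * int q) - int p * (b * (int q' - int q))"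
      by (rule dvd_diff[OF dvd_mult dvd_triv_left])
    also have "a * ((N + int u) * int q' - (N + int u') * int q) - int p * (b * (int q' - int q)) =
        r * (int q' - int q) + a * (int u * int q' - int u' * int q)"
      by (simp add: r_def algebra_simps)
    finally have dvd: "int p dvd r * (int q' - int q) + a * (int u * int q' - int u' * int q)" .
    have "\<bar>r * (int q' - int q)\<bar> \<le> \<bar>r\<bar> * int Q"
      unfolding abs_mult using q by (intro mult_left_mono) auto
    moreover have "\<bar>a * (int u * int q' - int u' * int q)\<bar> \<le> int (2 * Q) * (int H * int Q)"
    proof -
      have "int u * int q' \<le> int H * int Q" "int u' * int q \<le> int H * int Q"
        using q by (auto intro!: mult_mono)
      moreover have "0 \<le> int u * int q'" "0 \<le> int u' * int q" by simp_all
      ultimately have "\<bar>int u * int q' - int u' * int q\<bar> \<le> int H * int Q" by linarith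
      thus ?thesis unfolding abs_mult using ba by (intro mult_mono) auto
    qed
    moreover have "2 * (int (2 * Q) * (int H * int Q)) \<le> int p"
    proof -
      have "int (4 * Q ^ 2 * H) \<le> int p" using assms(5) by (rule of_nat_mono)
      thus ?thesis by (simp add: power2_eq_square mult_ac)
    qed
    moreover have "2 * (\<bar>r\<bar> * int Q) < int p" using r by (simp add: mult_ac)
    ultimately have "\<bar>r * (int q' - int q) + a * (int u * int q' - int u' * int q)\<bar> < int p"
      by linarith
    hence "r * (int q' - int q) + a * (int u * int q' - int u' * int q) = 0"
      using dvd by (metis abs_of_nat dvd_imp_le_int not_less)
    hence eq': "(r + a * int u) * int q' = (r + a * int u') * int q" by (simp add: algebra_simps)
    have cu: "coprime (int q) (r + a * int u)" "coprime (int q') (r + a * int u')"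
      using uq by (auto simp: G_def coprime_commute)
    have "int q dvd (r + a * int u) * int q'" by (simp add: eq')
    hence "int q dvd int q'" using cu(1) by (simp only: coprime_dvd_mult_right_iff)
    moreover have "int q' dvd (r + a * int u') * int q" by (simp flip: eq')
    hence "int q' dvd int q" using cu(2) by (simp only: coprime_dvd_mult_right_iff)
    ultimately have "q = q'" by (simp add: dvd_antisym)
    moreover have "u = u'" using eq' \<open>q = q'\<close> q ba(2) by simp
    ultimately show "u = u' \<and> q = q'" by simp
  qed
  hence "card G = card ((\<lambda>(u, q). of_int (N + int u) / of_nat q :: 'a) ` G)"
    by (rule card_image[symmetric])
  also have "\<dots> \<le> card ((\<lambda>(u, q). of_int (N + int u) / of_nat q :: 'a) ` ({1..H} \<times> {1..Q}))"
    by (intro card_mono image_mono) (auto simp: G_def)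
  finally show ?thesis using card_coprime_pairs_ge[OF cop, of H Q] by (simp add: G_def)
qed

section \<open>Characters and the length of runs\<close>

lemma powers_eq_imp_cong:
  fixes z :: "'a::field"
  assumes "z ^ n = 1" "n > 0"
  shows "\<exists>k>0. z ^ k = 1 \<and> (\<forall>i j. z ^ i = z ^ j \<longrightarrow> [i = j] (mod k))"
proof -
  define k where "k = (LEAST k. k > 0 \<and> z ^ k = 1)"
  have k: "k > 0" "z ^ k = 1"
    using LeastI[of "\<lambda>k. k > 0 \<and> z ^ k = 1" n] assms unfolding k_def by auto
  have z: "z \<noteq> 0" using assms by (auto simp: power_0_left)
  have *: "k dvd d" if "z ^ d = 1" for d
  proof -
    have "z ^ d = z ^ (k * (d div k) + d mod k)" by simp
    also have "\<dots> = z ^ (d mod k)" by (simp only: power_add power_mult k(2)) simp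
    finally have "z ^ (d mod k) = 1" using that by simp
    hence "\<not> d mod k > 0" using not_less_Least[of "d mod k" "\<lambda>k. k > 0 \<and> z ^ k = 1"] k(1)
      by (auto simp flip: k_def)
    thus ?thesis by (simp add: dvd_eq_mod_eq_0)
  qed
  have "[i = j] (mod k)" if "z ^ i = z ^ j" for i j
    using that
  proof (induction i j rule: linorder_wlog)
    case (le i j)
    have "z ^ j = z ^ i * z ^ (j - i)" using le(1) by (simp flip: power_add)
    hence "z ^ (j - i) = 1" using le(2) z by simp
    hence "[j = i] (mod k)" using * le(1) by (simp add: cong_altdef_nat)
    thus ?case by (rule cong_sym)
  qed (auto simp: cong_sym)
  thus ?thesis using k by blast
qed

lemma dirichlet_character_cong:
  assumes "dirichlet_character p chi" "[a = b] (mod int p)"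
  shows "chi a = chi b"
proof -
  have per: "chi (n + int p) = chi n" for n
    using assms(1) by (simp add: dirichlet_character_def)
  have nat: "chi (n + int m * int p) = chi n" for n m
  proof (induction m)
    case (Suc m)
    have "chi (n + int (Suc m) * int p) = chi ((n + int m * int p) + int p)"
      by (simp add: algebra_simps)
    thus ?case using Suc by (simp only: per)
  qed simp
  obtain z where z: "b = a + z * int p"
    using assms(2) by (metis cong_iff_lin mult.commute)
  show ?thesis
  proof (cases "z \<ge> 0")
    case True
    thus ?thesis using nat[of a "nat z"] by (simp add: z)
  next
    case False
    thus ?thesis using nat[of b "nat (- z)"] by (simp add: z)
  qed
qed

text \<open>Here \<open>k\<close> is the order of the value of \<open>chi\<close> at a primitive
  root. Equal nonzero values mean indices congruent modulo \<open>k\<close>, and multiplication by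
  \<open>g\<close> makes them congruent modulo \<open>p - 1\<close>; \<open>k = 1\<close> would make
  \<open>chi\<close> principal. The complex values thus become an algebraic condition over the field
  with \<open>p\<close> elements.\<close>

lemma dirichlet_character_power_residue:
  assumes "prime p" "dirichlet_character p chi" "chi \<noteq> principal_character p"
  shows "\<exists>g k. k \<ge> 2 \<and> g * k + 1 = p \<and>
    (\<forall>a b. chi a = chi b \<longrightarrow> chi a \<noteq> 0 \<longrightarrow> [a ^ g = b ^ g] (mod int p))"
proof -
  have p: "p > 1" using assms(1) by (rule prime_gt_1_nat)
  have mult: "chi (m * n) = chi m * chi n" and nz: "chi m \<noteq> 0 \<longleftrightarrow> coprime m (int p)" for m n
    using assms(2) by (auto simp: dirichlet_character_def)
  have "chi 1 * chi 1 = chi 1" "chi 1 \<noteq> 0" using mult[of 1 1] nz[of 1] by auto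
  hence one: "chi 1 = 1" by simp
  have pow: "chi (m ^ n) = chi m ^ n" for m n
    by (induction n) (simp_all add: one mult)
  obtain \<gamma> where \<gamma>: "residue_primroot p \<gamma>"
    using prime_primitive_root_exists[of p] p assms(1) by auto
  have cop: "coprime p \<gamma>" and ord: "ord p \<gamma> = p - 1"
    using \<gamma> assms(1) by (auto simp: residue_primroot_def totient_prime)
  have gen: "\<exists>i. [a = int \<gamma> ^ i] (mod int p)" if "chi a \<noteq> 0" for a
  proof -
    define m where "m = nat (a mod int p)"
    have m: "int m = a mod int p" using p by (simp add: m_def)
    have "coprime (a mod int p) (int p)" using that nz p by (simp add: coprime_commute)
    hence "coprime m p" by (simp flip: m)
    moreover have "int m < int p" unfolding m using p by simp
    hence "m < p" by simp
    moreover have "m > 0" using \<open>coprime m p\<close> p by (cases m) auto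
    ultimately have "m \<in> totatives p" by (simp add: totatives_def)
    then obtain i where "m = \<gamma> ^ i mod p"
      using residue_primroot_is_generator[OF p \<gamma>] by (auto simp: bij_betw_def)
    hence "int m = int \<gamma> ^ i mod int p" by (simp add: zmod_int)
    hence "[a = int \<gamma> ^ i] (mod int p)" using m by (simp add: Cong.cong_def)
    thus ?thesis by blast
  qed
  define z where "z = chi (int \<gamma>)"
  have chi_pow: "chi a = z ^ i" if "[a = int \<gamma> ^ i] (mod int p)" for a i
    using dirichlet_character_cong[OF assms(2) that] by (simp add: z_def pow)
  have "[\<gamma> ^ (p - 1) = 1] (mod p)" using ord_divides[of \<gamma> "p - 1" p] ord by simp
  hence "[1 = int \<gamma> ^ (p - 1)] (mod int p)"
    by (metis cong_int_iff cong_sym of_nat_1 of_nat_power)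
  hence zp: "z ^ (p - 1) = 1" using chi_pow one by simp
  then obtain k where k: "k > 0" "z ^ k = 1" "\<And>i j. z ^ i = z ^ j \<Longrightarrow> [i = j] (mod k)"
    using powers_eq_imp_cong[of z "p - 1"] p by auto
  have "[p - 1 = 0] (mod k)" using zp by (intro k(3)) simp
  hence "k dvd p - 1" by (simp add: cong_0_iff)
  then obtain g where "p - 1 = k * g" by (elim dvdE)
  hence g: "p - 1 = g * k" by simp
  have "k \<noteq> 1"
  proof
    assume "k = 1"
    hence z1: "z = 1" using k by simp
    have "chi n = principal_character p n" for n
    proof (cases "chi n = 0")
      case True
      thus ?thesis using nz[of n] by (simp add: principal_character_def)
    next
      case False
      thus ?thesis using gen[OF False] chi_pow z1 nz[of n] by (auto simp: principal_character_def)
    qed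
    thus False using assms(3) by blast
  qed
  moreover have "[a ^ g = b ^ g] (mod int p)" if ab: "chi a = chi b" "chi a \<noteq> 0" for a b
  proof -
    obtain i j where ij: "[a = int \<gamma> ^ i] (mod int p)" "[b = int \<gamma> ^ j] (mod int p)"
      using gen[of a] gen[of b] ab by auto
    have "z ^ i = z ^ j" using chi_pow[OF ij(1)] chi_pow[OF ij(2)] ab by simp
    hence "[i = j] (mod k)" by (rule k(3))
    hence "[i * g = j * g] (mod (p - 1))"
      unfolding g Cong.cong_def by (simp add: mult.commute flip: mult_mod_right)
    hence "[\<gamma> ^ (i * g) = \<gamma> ^ (j * g)] (mod p)"
      using order_divides_expdiff[OF cop] ord by simp
    hence "[int \<gamma> ^ (i * g) = int \<gamma> ^ (j * g)] (mod int p)"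
      by (metis cong_int_iff of_nat_power)
    moreover have "[a ^ g = int \<gamma> ^ (i * g)] (mod int p)" "[b ^ g = int \<gamma> ^ (j * g)] (mod int p)"
      using cong_pow[OF ij(1), of g] cong_pow[OF ij(2), of g] by (simp_all add: power_mult)
    ultimately show ?thesis by (meson cong_sym cong_trans)
  qed
  ultimately show ?thesis using k(1) g p by (intro exI[of _ g] exI[of _ k]) auto
qed

text \<open>If \<open>k\<close> is large, then the condition for \<open>j = 1\<close> alone has at
  most \<open>g\<close> solutions, which is few enough. Otherwise the auxiliary polynomial is
  applied with vanishing order \<open>2 * Z ^ 2\<close> and \<open>J = W\<close>, using only
  \<open>m + 1\<close> of the \<open>W\<close> linear factors.\<close>

lemma card_consecutive_power_residues_le:
  fixes V :: "'a::field set" and p g k W Z :: nat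
  assumes p: "CHAR('a) = p" and gk: "g * k + 1 = p" "k \<ge> 2"
    and Z: "16 * Z ^ 4 \<le> p" "Z \<ge> 2" and W: "4 ^ W \<le> p" "p < 4 ^ (W + 1)" "W \<ge> 8"
    and V: "\<And>v. v \<in> V \<Longrightarrow> v ^ p = v"
      "\<And>v j. v \<in> V \<Longrightarrow> j \<in> {1..W} \<Longrightarrow> (1 - of_nat j * v) ^ g = 1"
  shows "4 * Z ^ 2 * card V \<le> 3 * p * W"
proof -
  have p1: "p > 1" using power_mono[OF Z(2), of 4] Z(1) by simp
  have "g > 0" using p1 gk by (cases g) auto
  show ?thesis
  proof (cases "k * W \<ge> 4 * Z ^ 2")
    case True
    define P where "P = [:1, -1 :: 'a:] ^ g - 1"
    have dP: "degree ([:1, -1 :: 'a:] ^ g) = g" by (rule degree_linear_power) simp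
    have "P \<noteq> 0"
    proof
      assume "P = 0"
      hence "[:1, -1 :: 'a:] ^ g = 1" by (simp add: P_def)
      thus False using dP \<open>g > 0\<close> by simp
    qed
    have "V \<subseteq> {v. poly P v = 0}" using V(2)[of _ 1] W(3) by (auto simp: P_def)
    hence "card V \<le> card {v. poly P v = 0}"
      using poly_roots_finite[OF \<open>P \<noteq> 0\<close>] by (intro card_mono)
    also have "\<dots> \<le> degree P" using \<open>P \<noteq> 0\<close> by (rule card_poly_roots_bound)
    also have "\<dots> \<le> g" unfolding P_def using dP by (intro degree_diff_le) auto
    finally have "card V \<le> g" .
    with True have "4 * Z ^ 2 * card V \<le> (k * W) * g" by (rule mult_mono) simp_all
    also have "\<dots> = (g * k) * W" by simp
    also have "\<dots> \<le> 3 * p * W" using gk by (intro mult_right_mono) auto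
    finally show ?thesis .
  next
    case False
    \<comment> \<open>The number \<open>k * 2 ^ m\<close> of exponent vectors is tuned to the range from \<open>4 Z\<^sup>2 / W\<close> to \<open>8 Z\<^sup>2 / W\<close>.\<close>
    define m where "m = (LEAST m. k * 2 ^ m * W \<ge> 4 * Z ^ 2)"
    have "4 * Z ^ 2 \<le> 2 ^ (4 * Z ^ 2)" using less_exp[of "4 * Z ^ 2"] by simp
    also have "\<dots> \<le> k * 2 ^ (4 * Z ^ 2) * W" using gk W by simp
    finally have m: "k * 2 ^ m * W \<ge> 4 * Z ^ 2" unfolding m_def by (rule LeastI)
    have "m \<noteq> 0" using m False by (cases m) auto
    then obtain m' where m': "m = Suc m'" by (cases m) auto
    have "\<not> k * 2 ^ m' * W \<ge> 4 * Z ^ 2" 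
    proof -
      have "m' < m" by (simp add: m')
      thus ?thesis unfolding m_def by (rule not_less_Least)
    qed
    hence nW: "k * 2 ^ m * W < 8 * Z ^ 2" by (simp add: m' mult_ac)
    define n where "n = k * 2 ^ m"
    have n2: "2 * 2 ^ m \<le> n" unfolding n_def using gk(2) by (intro mult_right_mono) auto
    \<comment> \<open>Taking the square root of 16 Z^4 < 4^(W+1) limits \<open>m\<close>, so that
      enough factors are available.\<close>
    have "(4 * Z ^ 2) ^ 2 < (2 ^ (W + 1)) ^ 2"
    proof -
      have "(4 * Z ^ 2) ^ 2 = 16 * Z ^ 4" by (simp add: power_mult_distrib flip: power_mult)
      also have "\<dots> < 4 ^ (W + 1)" using Z W by linarith
      also have "(4::nat) ^ (W + 1) = (2 ^ 2) ^ (W + 1)" by simp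
      also have "\<dots> = (2 ^ (W + 1)) ^ 2" by (simp only: power_mult[symmetric] mult.commute)
      finally show ?thesis .
    qed
    hence Z2: "4 * Z ^ 2 < 2 ^ (W + 1)" by (rule power_less_imp_less_base) simp
    have "2 ^ m * 8 \<le> 2 ^ m * W" using W by simp
    also have "\<dots> < 4 * Z ^ 2"
      using nW mult_right_mono[OF n2, of W] unfolding n_def by linarith
    also note Z2
    finally have "(2::nat) ^ (m + 3) < 2 ^ (W + 1)" by (simp add: power_add)
    hence mW: "m + 3 < W + 1" by (rule power_less_imp_less_exp[rotated]) simp
    \<comment> \<open>This value makes the comparison of equations and unknowns, for order
      \<open>2 * Z ^ 2\<close> and \<open>J = W\<close>, equivalent to
      \<open>m + 1 \<le> W\<close>.\<close>
    define A where "A = W + W * Z ^ 2"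
    have nW': "n * W \<le> 8 * Z ^ 2" using nW by (simp add: n_def)
    \<comment> \<open>Multiplied by \<open>k\<close>, the right side is p - 1 >= 16 Z^4 - 1, while
      the left side is at most 12 Z^4 + 8 Z^2 <= 14 Z^4.\<close>
    have indep: "2 ^ m * A + 2 ^ m * 2 ^ m * (m + 1) \<le> g"
    proof -
      have "n * 2 ^ m * W * W * 2 = (n * W) * (2 * 2 ^ m * W)" by simp
      also have "\<dots> \<le> (n * W) * (n * W)" using n2 by (intro mult_left_mono mult_right_mono) auto
      also have "\<dots> \<le> (8 * Z ^ 2) * (8 * Z ^ 2)" by (rule mult_mono[OF nW' nW']) simp_all
      finally have "n * 2 ^ m * W * W \<le> 32 * Z ^ 4" by (simp add: power2_eq_square power4_eq_xxxx mult_ac)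
      moreover have "n * 2 ^ m * W * 8 \<le> n * 2 ^ m * W * W" using W by (intro mult_left_mono) auto
      ultimately have 1: "n * 2 ^ m * W \<le> 4 * Z ^ 4" by linarith
      have 2: "n * 2 ^ m * (m + 1) \<le> n * 2 ^ m * W" using mW by (intro mult_left_mono) auto
      have "n * A = (n * W) * (1 + Z ^ 2)" by (simp add: A_def algebra_simps)
      also have "\<dots> \<le> (8 * Z ^ 2) * (1 + Z ^ 2)" by (rule mult_right_mono[OF nW']) simp
      also have "\<dots> = 8 * Z ^ 2 + 8 * Z ^ 4" by (simp add: algebra_simps power2_eq_square power4_eq_xxxx)
      finally have 3: "n * A \<le> 8 * Z ^ 2 + 8 * Z ^ 4" .
      have "4 * Z ^ 2 \<le> Z ^ 2 * Z ^ 2"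
        using power_mono[OF Z(2), of 2] by (intro mult_right_mono) auto
      hence 4: "4 * Z ^ 2 \<le> Z ^ 4" by (simp add: power2_eq_square power4_eq_xxxx mult_ac)
      have 5: "Z ^ 4 > 0" using Z(2) by simp
      have "k * (2 ^ m * A + 2 ^ m * 2 ^ m * (m + 1)) = n * A + n * 2 ^ m * (m + 1)"
        by (simp add: n_def algebra_simps)
      also have "\<dots> \<le> k * g" using 1 2 3 4 5 Z(1) gk(1) by (simp add: mult.commute[of k])
      finally show ?thesis using gk(2) by simp
    qed
    have Ag: "A \<le> g"
    proof -
      have "1 * A \<le> 2 ^ m * A" by (intro mult_right_mono) auto
      thus ?thesis using indep by linarith
    qed
    have g2: "2 * g \<le> p"
    proof -
      have "g * 2 \<le> g * k" using gk(2) by (intro mult_left_mono) auto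
      thus ?thesis using gk(1) by linarith
    qed
    have Wp: "W < p" using W(1) less_exp[of W] power_mono[of "2::nat" 4 W] by linarith
    have "card V * (2 * Z ^ 2) \<le> A + p * W + g * (m + 1)"
    proof (rule stepanov_card_bound_linear_factors[where c = "\<lambda>i. of_nat (Suc i)" and k = k])
      have *: "(of_nat i = (of_nat j :: 'a)) \<longleftrightarrow> i = j" if "i < p" "j < p" for i j
        using that p by (simp add: of_nat_eq_iff_cong_CHAR Cong.cong_def)
      show "of_nat (Suc i) \<noteq> (0 :: 'a)" if "i < m + 1" for i
        using *[of "Suc i" 0] that mW Wp by (simp del: of_nat_Suc)
      show "inj_on (\<lambda>i. of_nat (Suc i) :: 'a) {..<m + 1}"
        using * mW Wp by (intro inj_onI) (auto simp del: of_nat_Suc)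
      show "(1 - of_nat (Suc i) * v) ^ g = 1" if "v \<in> V" "i < m + 1" for v i
        using V(2)[OF that(1), of "Suc i"] that(2) mW by (auto simp del: of_nat_Suc)
      have "8 * Z ^ 2 * A \<le> 2 * ((k * 2 ^ m * W) * A)"
      proof -
        have "(4 * Z ^ 2) * A \<le> (k * 2 ^ m * W) * A" using m by (rule mult_right_mono) simp
        thus ?thesis by (simp add: mult_ac)
      qed
      moreover have "2 * (2 * Z ^ 2) * (A + W) + (m + 1) * (2 * Z ^ 2) * (2 * Z ^ 2) \<le> 8 * Z ^ 2 * A"
      proof -
        have "(m + 1) * ((2 * Z ^ 2) * (2 * Z ^ 2)) \<le> W * ((2 * Z ^ 2) * (2 * Z ^ 2))"
          using mW by (intro mult_right_mono) auto
        thus ?thesis by (simp add: A_def algebra_simps)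
      qed
      ultimately show "2 * (2 * Z\<^sup>2) * (A + W) + (m + 1) * (2 * Z\<^sup>2) * (2 * Z\<^sup>2)
          \<le> 2 * (k * 2 ^ (m + 1 - 1) * W * A)"
        by (simp only: add_diff_cancel_right')
      show "2 ^ (m + 1 - 1) * A + 2 ^ (m + 1 - 1) * 2 ^ (m + 1 - 1) * (m + 1) \<le> g" using indep by simp
      show "2 * Z ^ 2 \<le> p"
      proof -
        have "Z ^ 2 \<le> Z ^ 4" using Z(2) by (intro power_increasing) auto
        thus ?thesis using Z(1) by linarith
      qed
    qed (use p p1 gk V(1) W Z Ag g2 in \<open>auto simp: A_def\<close>)
    \<comment> \<open>The spare \<open>g\<close> pays for \<open>A\<close>; the remaining
      \<open>g * W\<close> is at most half of \<open>p * W\<close>, whence the factor 3/2.\<close>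
    moreover have "g * (m + 1) + g \<le> g * W"
    proof -
      have "g * (m + 2) \<le> g * W" using mW by (intro mult_left_mono) auto
      thus ?thesis by (simp add: algebra_simps)
    qed
    moreover have "2 * g * W \<le> p * W" using g2 by (intro mult_right_mono) auto
    ultimately have "2 * (card V * (2 * Z ^ 2)) \<le> 2 * (p * W) + p * W" using Ag by linarith
    thus ?thesis by (simp add: mult_ac)
  qed
qed

text \<open>Half of the run holds the numerators N + u with u <= 8 W Z; the other half leaves room
  for the shifts j q <= W * 8 Z. The resulting 16 (W - 2) Z^2 quotients contradict the upper bound 3
  p W / (4 Z^2), because p <= 17 Z^4.\<close>

lemma run_length_less:
  fixes chi :: "int \<Rightarrow> complex" and N :: int and p W Z :: nat
  assumes card: "CARD('a::finite_field) = p" "CHAR('a) = p"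
    and chi: "prime p" "dirichlet_character p chi" "chi \<noteq> principal_character p"
    and run: "\<And>n. n \<in> {N<..N + int (16 * W * Z)} \<Longrightarrow> chi n = c"
    and Z: "16 * Z ^ 4 \<le> p" "p < 16 * (Z + 1) ^ 4" "128 * W \<le> Z"
    and W: "4 ^ W \<le> p" "p < 4 ^ (W + 1)" "W \<ge> 30"
  shows False
proof -
  have p1: "p > 1" using chi(1) by (rule prime_gt_1_nat)
  have Z0: "Z \<ge> 3840" using Z(3) W(3) by linarith
  have nz: "chi n \<noteq> 0 \<longleftrightarrow> coprime n (int p)" for n
    using chi(2) by (auto simp: dirichlet_character_def)
  have WZ: "W * Z \<ge> 30 * 3840" using Z0 W(3) by (intro mult_mono) auto
  have c0: "c \<noteq> 0"
  proof
    assume "c = 0"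
    have "2 \<le> 16 * W * Z" using WZ unfolding mult.assoc by linarith
    hence "int 2 \<le> int (16 * W * Z)" by (simp only: of_nat_le_iff)
    hence "N + 1 \<in> {N<..N + int (16 * W * Z)}" "N + 2 \<in> {N<..N + int (16 * W * Z)}"
      by (simp_all del: of_nat_mult)
    hence "chi (N + 1) = 0" "chi (N + 2) = 0" using run \<open>c = 0\<close> by blast+
    hence "\<not> coprime (N + 1) (int p)" "\<not> coprime (N + 2) (int p)" using nz by auto
    moreover have "int p dvd n" if "\<not> coprime n (int p)" for n
      using that prime_imp_coprime[of "int p" n] chi(1) by (subst (asm) coprime_commute) auto
    ultimately have "int p dvd N + 1" "int p dvd N + 2" by blast+
    hence "int p dvd (N + 2) - (N + 1)" by (rule dvd_diff[rotated])
    thus False using p1 by simp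
  qed
  obtain g k where gk: "k \<ge> 2" "g * k + 1 = p"
    "\<And>a b. chi a = chi b \<Longrightarrow> chi a \<noteq> 0 \<Longrightarrow> [a ^ g = b ^ g] (mod int p)"
    using dirichlet_character_power_residue[OF chi] by blast
  define X where "X = (\<lambda>(u, q). of_int (N + int u) / of_nat q :: 'a) ` ({1..8 * W * Z} \<times> {1..8 * Z})"
  have "real (8 * W * Z) * real (8 * Z) / 4 - real (8 * Z) ^ 2 / 2 \<le> real (card X)"
    unfolding X_def
  proof (rule card_ratios_ge[OF chi(1) card(2)])
    have "4 * (8 * Z) ^ 2 * (8 * W * Z) = 16 * (128 * W) * Z ^ 3"
      by (simp add: power2_eq_square power3_eq_cube)
    also have "\<dots> \<le> 16 * Z * Z ^ 3" using Z(3) by (intro mult_mono) auto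
    also have "\<dots> = 16 * Z ^ 4" by (simp add: power3_eq_cube power4_eq_xxxx)
    finally show "4 * (8 * Z) ^ 2 * (8 * W * Z) \<le> p" using Z(1) by linarith
  qed (use Z0 W(3) in auto)
  hence cardX: "16 * (real W - 2) * real Z ^ 2 \<le> real (card X)"
    by (simp add: algebra_simps power2_eq_square)
  \<comment> \<open>With \<open>v = -1/x\<close> the quotient \<open>(x + j) / x\<close> becomes the polynomial \<open>1 - j v\<close>.\<close>
  define V where "V = (\<lambda>x. - inverse x) ` X"
  have "card V = card X" unfolding V_def by (intro card_image inj_onI) simp
  have "4 * Z ^ 2 * card V \<le> 3 * p * W"
  proof (rule card_consecutive_power_residues_le[OF card(2) gk(2,1) Z(1) _ W(1,2)])
    show "v ^ p = v" for v :: 'a using finite_field_power_card_eq_same[of v] card(1) by simp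
    fix v j assume v: "v \<in> V" and j: "j \<in> {1..W}"
    obtain u q where uq: "u \<in> {1..8 * W * Z}" "q \<in> {1..8 * Z}"
      "v = - inverse (of_int (N + int u) / of_nat q)"
      using v by (auto simp: V_def X_def)
    have jq: "j * q \<le> W * (8 * Z)" using j uq by (intro mult_mono) auto
    define y where "y = N + int u"
    have y: "chi y = c" "chi (y + int (j * q)) = c"
      using uq jq by (auto intro!: run simp: y_def mult_ac simp del: of_nat_mult)
    have "[(y + int (j * q)) ^ g = y ^ g] (mod int p)" using gk(3) y c0 by simp
    hence eq: "of_int ((y + int (j * q)) ^ g) = (of_int (y ^ g) :: 'a)"
      by (simp only: of_int_eq_iff_cong_CHAR card(2))
    have "\<not> int p dvd y" using y(1) c0 nz[of y] p1
      by (metis coprime_common_divisor dvd_refl zdvd1_eq abs_of_nat of_nat_1_eq_iff less_irrefl)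
    hence y0: "of_int y \<noteq> (0 :: 'a)" by (simp add: of_int_eq_0_iff_char_dvd card(2))
    have "1 - of_nat j * v = of_int (y + int (j * q)) / of_int y"
      unfolding uq(3) y_def[symmetric] using y0 by (simp add: field_simps)
    hence "(1 - of_nat j * v) ^ g = of_int ((y + int (j * q)) ^ g) / of_int (y ^ g)"
      by (simp only: power_divide of_int_power)
    also have "\<dots> = 1" unfolding eq using y0 by simp
    finally show "(1 - of_nat j * v) ^ g = 1" .
  qed (use Z0 W(3) in auto)
  hence "real (4 * Z ^ 2 * card V) \<le> real (3 * p * W)" by (rule of_nat_mono)
  hence "4 * real Z ^ 2 * real (card X) \<le> 3 * real p * real W"
    by (simp add: \<open>card V = card X\<close>)
  moreover have "4 * real Z ^ 2 * (16 * (real W - 2) * real Z ^ 2) \<le> 4 * real Z ^ 2 * real (card X)"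
    using cardX by (intro mult_left_mono) auto
  ultimately have 1: "64 * (real W - 2) * real Z ^ 4 \<le> 3 * real p * real W"
    by (simp add: power2_eq_square power4_eq_xxxx algebra_simps)
  have "real p \<le> 16 * (real Z + 1) ^ 4"
  proof -
    have "real p \<le> real (16 * (Z + 1) ^ 4)" using Z(2) by (intro of_nat_mono) simp
    thus ?thesis by (simp add: add.commute)
  qed
  also have "(real Z + 1) ^ 4 \<le> (1001 / 1000 * real Z) ^ 4"
    using Z0 by (intro power_mono) auto
  also have "16 * (1001 / 1000 * real Z) ^ 4 = 16 * (1001 / 1000) ^ 4 * real Z ^ 4"
    unfolding power_mult_distrib by simp
  also have "\<dots> \<le> 17 * real Z ^ 4"
    by (intro mult_right_mono) (simp_all add: power4_eq_xxxx)
  finally have "real p \<le> 17 * real Z ^ 4" by simp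
  hence "3 * real p * real W \<le> 3 * (17 * real Z ^ 4) * real W"
    by (intro mult_right_mono mult_left_mono) auto
  with 1 have "(64 * (real W - 2)) * real Z ^ 4 \<le> (51 * real W) * real Z ^ 4" by (simp add: mult_ac)
  hence "64 * (real W - 2) \<le> 51 * real W" using Z0 by (simp add: mult_le_cancel_right)
  thus False using W(3) by simp
qed

section \<open>A field with p elements for a variable prime p\<close>

text \<open>Here \<open>Z\<close> is about \<open>p powr (1/4) / 2\<close> and \<open>W\<close> about \<open>log 4 p\<close>. A type of residues modulo \<open>p\<close> cannot
  depend on a variable \<open>p\<close>, so it is formed for one fixed prime that violates the theorem if any does.\<close>

definition long_run :: "nat \<Rightarrow> bool" where
  "long_run p \<longleftrightarrow> prime p \<and>
     (\<exists>chi N W Z c. dirichlet_character p chi \<and> chi \<noteq> principal_character p \<and>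
        (\<forall>n\<in>{N<..N + int (16 * W * Z)}. chi n = c) \<and>
        16 * Z ^ 4 \<le> p \<and> p < 16 * (Z + 1) ^ 4 \<and> 128 * W \<le> Z \<and>
        4 ^ W \<le> p \<and> p < 4 ^ (W + 1) \<and> W \<ge> 30)"

definition critical_prime :: nat where
  "critical_prime = (SOME p. prime p \<and> ((\<exists>q. long_run q) \<longrightarrow> long_run p))"

lemma critical_prime_props:
  shows "prime critical_prime" "long_run q \<Longrightarrow> long_run critical_prime"
proof -
  have "\<exists>p. prime p \<and> ((\<exists>q. long_run q) \<longrightarrow> long_run p)"
  proof (cases "\<exists>q. long_run q")
    case True
    thus ?thesis using long_run_def by blast
  next
    case False
    thus ?thesis using two_is_prime_nat by blast
  qed
  from someI_ex[OF this]
  show "prime critical_prime" "long_run q \<Longrightarrow> long_run critical_prime"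
    unfolding critical_prime_def[symmetric] by blast+
qed

typedef residue_index = "{..<critical_prime}"
  using prime_gt_0_nat[OF critical_prime_props(1)] by auto

lemma card_residue_index: "CARD(residue_index) = critical_prime"
  using type_definition.card[OF type_definition_residue_index] by simp

instance residue_index :: prime_card
  by standard (simp add: card_residue_index critical_prime_props(1))

lemma not_long_run: "\<not> long_run p"
proof
  assume "long_run p"
  hence "long_run critical_prime" by (rule critical_prime_props(2))
  then obtain chi N W Z c where *: "prime critical_prime" "dirichlet_character critical_prime chi"
      "chi \<noteq> principal_character critical_prime"
      "\<And>n. n \<in> {N<..N + int (16 * W * Z)} \<Longrightarrow> chi n = c"
      "16 * Z ^ 4 \<le> critical_prime" "critical_prime < 16 * (Z + 1) ^ 4" "128 * W \<le> Z"
      "4 ^ W \<le> critical_prime" "critical_prime < 4 ^ (W + 1)" "W \<ge> 30"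
    unfolding long_run_def by blast
  have "CARD(residue_index mod_ring) = critical_prime" "CHAR(residue_index mod_ring) = critical_prime"
    by (simp_all add: card_residue_index)
  from run_length_less[OF this *] show False .
qed

text \<open>Since 65536 = 4 * 128^2, the square of this inequality is 16 (128 W)^4 <= 4^W. It
  provides \<open>128 * W \<le> Z\<close>, which the distinctness of the quotients demands.\<close>

lemma square_le_power_of_two:
  fixes W :: nat
  assumes "W \<ge> 30"
  shows "65536 * W ^ 2 \<le> 2 ^ W"
  using assms
proof (induction W rule: dec_induct)
  case (step n)
  have "(Suc n) ^ 2 \<le> 2 * n ^ 2"
  proof -
    have "30 * n \<le> n * n" using step by (intro mult_right_mono) auto
    moreover have "(Suc n) ^ 2 = n * n + 2 * n + 1" "2 * n ^ 2 = n * n + n * n"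
      by (simp_all add: power2_eq_square)
    ultimately show ?thesis using step(1) by linarith
  qed
  thus ?case using step by simp
qed simp

lemma run_length_bound:
  fixes p :: nat and chi :: "int \<Rightarrow> complex" and N H :: int
  assumes "prime p" "dirichlet_character p chi" "chi \<noteq> principal_character p"
    and run: "\<And>n. n \<in> {N<..N + H} \<Longrightarrow> chi n = c"
    and large: "real p \<ge> 5 * 10 ^ 18"
  shows "real_of_int H < 7 * real p powr (1 / 4) * ln (real p)"
proof (rule ccontr)
  assume contra: "\<not> real_of_int H < 7 * real p powr (1 / 4) * ln (real p)"
  have "real (5 * 10 ^ 18) \<le> real p" using large by simp
  hence p: "5 * 10 ^ 18 \<le> p" by (simp only: of_nat_le_iff)
  obtain W where W: "4 ^ W \<le> p" "p < 4 ^ (W + 1)"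
    using ex_power_ivl1[of 4 p] p by auto
  \<comment> \<open>The threshold for \<open>p\<close> enters here, through 4^30 < 5 *
    10^18.\<close>
  have W30: "W \<ge> 30"
  proof (rule ccontr)
    assume "\<not> W \<ge> 30"
    hence "(4::nat) ^ (W + 1) \<le> 4 ^ 30" by (intro power_increasing) auto
    thus False using p W(2) by simp
  qed
  define Y where "Y = (LEAST Y. p < 16 * Y ^ 4)"
  have "p < 16 * p ^ 4"
  proof -
    have "p ^ 1 \<le> p ^ 4" using p by (intro power_increasing) auto
    thus ?thesis using p by simp
  qed
  hence Y: "p < 16 * Y ^ 4" unfolding Y_def by (rule LeastI)
  then obtain Z where Z': "Y = Suc Z" by (cases Y) auto
  hence "\<not> p < 16 * Z ^ 4" unfolding Y_def by (intro not_less_Least) simp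
  hence Z: "16 * Z ^ 4 \<le> p" "p < 16 * (Z + 1) ^ 4" using Y Z' by simp_all
  have WZ: "128 * W \<le> Z"
  proof (rule ccontr)
    assume "\<not> 128 * W \<le> Z"
    hence "Z + 1 \<le> 128 * W" by simp
    hence "16 * (Z + 1) ^ 4 \<le> 16 * (128 * W) ^ 4" by (intro mult_left_mono power_mono) auto
    also have "\<dots> = (65536 * W ^ 2) ^ 2" by (simp add: power_mult_distrib flip: power_mult)
    also have "\<dots> \<le> (2 ^ W) ^ 2" using square_le_power_of_two[OF W30] by (rule power_mono) simp
    also have "\<dots> = (2 ^ 2) ^ W" by (simp only: power_mult[symmetric] mult.commute)
    finally show False using Z(2) W(1) by simp
  qed
  \<comment> \<open>The product splits as 2 Z * 8 W, where 2 Z <= p^(1/4) and ln 2 >= 2/3 gives even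
    8 W <= 6 ln p.\<close>
  have "real (16 * W * Z) \<le> 7 * real p powr (1 / 4) * ln (real p)"
  proof -
    have "real (2 * Z) = (real (2 * Z) powr 4) powr (1 / 4)"
      by (subst powr_powr) simp
    also have "real (2 * Z) powr 4 = real (16 * Z ^ 4)"
      by (cases "Z = 0") (simp_all add: power_mult_distrib)
    also have "\<dots> powr (1 / 4) \<le> real p powr (1 / 4)"
      by (rule powr_mono2[OF _ _ of_nat_mono[OF Z(1)]]) simp_all
    finally have 1: "real (2 * Z) \<le> real p powr (1 / 4)" .
    have "real W * ln 4 = ln (4 ^ W)" by (simp add: ln_realpow)
    also have "\<dots> = ln (real (4 ^ W))" by simp
    also have "\<dots> \<le> ln (real p)" using W(1) p by (subst ln_le_cancel_iff) (simp_all only: of_nat_le_iff, simp_all)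
    finally have "real W * ln 4 \<le> ln (real p)" .
    moreover have "ln (4::real) = 2 * ln 2" using ln_realpow[of 2 2] by simp
    ultimately have "real W * (2 * ln 2) \<le> ln (real p)" by simp
    moreover have "real W * (2 * (2 / 3)) \<le> real W * (2 * ln 2)"
      using ln2_ge_two_thirds by (intro mult_left_mono) auto
    ultimately have 2: "8 * real W \<le> 7 * ln (real p)" by simp
    have "real (16 * W * Z) = real (2 * Z) * (8 * real W)" by simp
    also have "\<dots> \<le> real p powr (1 / 4) * (7 * ln (real p))"
      by (rule mult_mono[OF 1 2]) simp_all
    finally show ?thesis by (simp add: mult_ac)
  qed
  hence "real_of_int (int (16 * W * Z)) \<le> real_of_int H" using contra by simp
  hence "int (16 * W * Z) \<le> H" by (simp only: of_int_le_iff)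
  hence "\<forall>n\<in>{N<..N + int (16 * W * Z)}. chi n = c" using run by auto
  hence "long_run p"
    unfolding long_run_def using assms(1-3) Z WZ W W30 by blast
  thus False using not_long_run by blast
qed

theorem theorem1p2:
  fixes p :: nat and chi :: "int \<Rightarrow> complex" and N H :: int
  assumes "prime p"
    and "dirichlet_character p chi"
    and "chi \<noteq> principal_character p"
    and "H \<ge> 1"
    and "\<exists>c. \<forall>n\<in>{N<..N + H}. chi n = c"
  shows "(real p \<ge> 5 * 10 ^ 18 \<longrightarrow> real_of_int H < 7.06 * real p powr (1 / 4) * ln (real p)) \<and>
         (real p \<ge> 5 * 10 ^ 55 \<longrightarrow> real_of_int H < 7 * real p powr (1 / 4) * ln (real p))"
proof -
  obtain c where c: "\<And>n. n \<in> {N<..N + H} \<Longrightarrow> chi n = c" using assms(5) by blast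
  \<comment> \<open>The constant 7 is reached on the whole range from 5 * 10^18 on, so one bound
    serves both cases.\<close>
  have bound: "real_of_int H < 7 * real p powr (1 / 4) * ln (real p)" if "real p \<ge> 5 * 10 ^ 18"
    using run_length_bound[OF assms(1-3) c that] .
  show ?thesis
  proof (intro conjI impI)
    assume large: "real p \<ge> 5 * 10 ^ 18"
    hence "7 * real p powr (1 / 4) * ln (real p) \<le> 7.06 * real p powr (1 / 4) * ln (real p)"
      by (intro mult_right_mono) auto
    with bound[OF large] show "real_of_int H < 7.06 * real p powr (1 / 4) * ln (real p)"
      by (rule less_le_trans)
  next
    assume "real p \<ge> 5 * 10 ^ 55"
    thus "real_of_int H < 7 * real p powr (1 / 4) * ln (real p)" by (intro bound) simp
  qed
qed

end
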